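(* For every natural number $n$, ordinal $\alpha$ and nested sequent $\Gamma$: if $\mathsf{D_C}\vdash^{\alpha}_{\omega\cdot n}\Gamma$ then $\mathsf{D_C}\vdash^{\varphi_1^n(\alpha)}_{0}\Gamma$.
   Context: Fix $h\ge1$ agents. Formulas: $A::=p\mid\bar p\mid A\vee A\mid A\wedge A\mid\Diamond_iA\mid\Box_iA\mid\widetilde{\mathsf C}A\mid\mathsf CA$ ($1\le i\le h$), $\widetilde{\mathsf C}$ the De Morgan dual of $\mathsf C$ (common knowledge); $\bar A$ by De Morgan laws. $\Box A:=\Box_1A\wedge\dots\wedge\Box_hA$, $\Diamond A:=\Diamond_1A\vee\dots\vee\Diamond_hA$, $\Box^k,\Diamond^k$ iterations. Rank: $rk(p)=rk(\bar p)=0$, $rk(A\wedge B)=rk(A\vee B)=\max(rk A,rk B)+1$, $rk(\Box_iA)=rk(\Diamond_iA)=rk(A)+1$, $rk(\mathsf CA)=rk(\widetilde{\mathsf C}A)=\omega+rk(A)$. Nested sequents: finite multisets of formulas and boxed sequents $[\Delta]_i$; contexts $\Gamma\{\ \}$. System $\mathsf{D_C}$ (premises / conclusion): axiom $\Gamma\{p,\bar p\}$; $\wedge$: $\Gamma\{A\},\Gamma\{B\}/\Gamma\{A\wedge B\}$; $\vee$: $\Gamma\{A,B\}/\Gamma\{A\vee B\}$; $\Box_i$: $\Gamma\{[A]_i\}/\Gamma\{\Box_iA\}$; $\Diamond_i$: $\Gamma\{\Diamond_iA,[\Delta,A]_i\}/\Gamma\{\Diamond_iA,[\Delta]_i\}$;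 $\mathsf C$: premises $\Gamma\{\Box^kA\}$ for all $k\ge1$ / $\Gamma\{\mathsf CA\}$; $\widetilde{\mathsf C}$: $\Gamma\{\widetilde{\mathsf C}A,\Diamond^kA\}/\Gamma\{\widetilde{\mathsf C}A\}$ (some $k\ge1$). Cut: $\Gamma\{A\},\Gamma\{\bar A\}/\Gamma\{\emptyset\}$ with cut rank $rk(A)$. Proofs: well-founded, possibly infinitely branching trees with axiom leaves; depth = least ordinal greater than the depths of the immediate subproofs. $\mathsf{D_C}\vdash^\alpha_\gamma\Gamma$ means a proof of $\Gamma$ in $\mathsf{D_C}$ plus cuts of rank $<\gamma$, of depth $\le\alpha$. Veblen function: $\varphi_0\beta=\omega^\beta$; for $\alpha>0$, $\varphi_\alpha\beta$ is the $(\beta+1)$-th common fixpoint of the functions $\xi\mapsto\varphi_\gamma\xi$ for all $\gamma<\alpha$. $\varphi_1^n$ denotes $n$-fold iteration of $\xi\mapsto\varphi_1\xi$. *)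

theory Defs
  imports "HOL-Library.Multiset" "HOL-Library.Infinite_Typeclass"
begin

section \<open>Ordinals\<close>

text \<open>
  An ordinal is the order type of a well-order. HOL has no type of all ordinals, so
  \<open>'o ordinal\<close> consists of the order types of well-orders on subsets of \<open>'o\<close>, that is, of the
  ordinals below the successor cardinal of \<open>'o\<close>. For infinite \<open>'o\<close> this is an initial segment
  of the ordinals with uncountable regular length. Hence every subset indexed by \<open>'o\<close> (in
  particular every countable subset, and every proper initial segment) is strictly bounded, the
  least elements in the definitions below all exist, and the operations are the usual ordinal
  operations. Larger ordinals are obtained by varying \<open>'o\<close>.
\<close>

quotient_type 'o ordinal = "'o rel" / partial: "\<lambda>r s. (r, s) \<in> ordIso"
proof (rule part_equivpI)
  show "\<exists>r :: 'o rel. (r, r) \<in> ordIso"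
    using card_of_Well_order ordIso_reflexive by blast
  show "symp (\<lambda>r s :: 'o rel. (r, s) \<in> ordIso)"
    by (auto simp: symp_def intro: ordIso_symmetric)
  show "transp (\<lambda>r s :: 'o rel. (r, s) \<in> ordIso)"
    by (auto simp: transp_def intro: ordIso_transitive)
qed

instantiation ordinal :: (type) wellorder
begin

lift_definition less_eq_ordinal :: "'a ordinal \<Rightarrow> 'a ordinal \<Rightarrow> bool"
  is "\<lambda>r s. (r, s) \<in> ordLeq"
  by (meson ordIso_ordLeq_trans ordIso_symmetric ordLeq_ordIso_trans)

lift_definition less_ordinal :: "'a ordinal \<Rightarrow> 'a ordinal \<Rightarrow> bool"
  is "\<lambda>r s. (r, s) \<in> ordLess"
  by (meson ordIso_ordLess_trans ordIso_symmetric ordLess_ordIso_trans)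

instance
proof
  fix x y z :: "'a ordinal"
  show "x < y \<longleftrightarrow> x \<le> y \<and> \<not> y \<le> x"
    by transfer
      (metis not_ordLeq_iff_ordLess ordIso_iff_ordLeq ordLeq_Well_order_simp ordLess_imp_ordLeq)
  show "x \<le> x"
    by transfer (simp add: ordIso_iff_ordLeq)
  show "x \<le> z" if "x \<le> y" "y \<le> z"
    using that by transfer (rule ordLeq_transitive)
  show "x = y" if "x \<le> y" "y \<le> x"
    using that by transfer (simp add: ordIso_iff_ordLeq)
  show "x \<le> y \<or> y \<le> x"
    by transfer (metis ordLeq_total ordIso_iff_ordLeq ordLeq_Well_order_simp)
next
  fix P :: "'a ordinal \<Rightarrow> bool" and a :: "'a ordinal"
  assume step: "\<And>x. (\<And>y. y < x \<Longrightarrow> P y) \<Longrightarrow> P x"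
  have "wfp ((<) :: 'a ordinal \<Rightarrow> 'a ordinal \<Rightarrow> bool)"
  proof -
    have "inv_image ordLess rep_ordinal = {(x, y :: 'a ordinal). x < y}"
      by (auto simp: inv_image_def less_ordinal.rep_eq)
    then show ?thesis
      using wf_inv_image[OF wf_ordLess, of "rep_ordinal :: 'a ordinal \<Rightarrow> 'a rel"]
      by (simp add: wfp_def)
  qed
  then show "P a"
    using step by (induction a rule: wfp_induct_rule) blast
qed

end

text \<open>The least ordinal greater than all elements of \<open>X\<close>.\<close>

definition lsub :: "'o ordinal set \<Rightarrow> 'o ordinal" where
  "lsub X = (LEAST \<delta>. \<forall>\<xi>\<in>X. \<xi> < \<delta>)"

function ord_add :: "'o ordinal \<Rightarrow> 'o ordinal \<Rightarrow> 'o ordinal" where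
  "ord_add \<alpha> \<beta> = (LEAST \<delta>. \<alpha> \<le> \<delta> \<and> (\<forall>\<gamma><\<beta>. ord_add \<alpha> \<gamma> < \<delta>))"
  by pat_completeness auto
termination
  by (relation "inv_image {(x, y). x < y} snd", rule wf_inv_image[OF wf], simp_all)
declare ord_add.simps [simp del]

function ord_mult :: "'o ordinal \<Rightarrow> 'o ordinal \<Rightarrow> 'o ordinal" where
  "ord_mult \<alpha> \<beta> = (LEAST \<delta>. \<forall>\<gamma><\<beta>. ord_add (ord_mult \<alpha> \<gamma>) \<alpha> \<le> \<delta>)"
  by pat_completeness auto
termination
  by (relation "inv_image {(x, y). x < y} snd", rule wf_inv_image[OF wf], simp_all)
declare ord_mult.simps [simp del]

instantiation ordinal :: (type) "{zero, one, plus, times}"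
begin

definition zero_ordinal :: "'a ordinal" where
  "0 = lsub {}"

definition one_ordinal :: "'a ordinal" where
  "1 = lsub {0}"

definition plus_ordinal :: "'a ordinal \<Rightarrow> 'a ordinal \<Rightarrow> 'a ordinal" where
  "plus_ordinal = ord_add"

definition times_ordinal :: "'a ordinal \<Rightarrow> 'a ordinal \<Rightarrow> 'a ordinal" where
  "times_ordinal = ord_mult"

instance ..

end

fun ord_of_nat :: "nat \<Rightarrow> 'o ordinal" where
  "ord_of_nat 0 = 0"
| "ord_of_nat (Suc n) = ord_of_nat n + 1"

definition omega :: "'o ordinal" where
  "omega = lsub (range ord_of_nat)"

text \<open>Ordinal exponentiation with base \<open>\<omega>\<close>: the supremum of \<open>1\<close> and all \<open>\<omega>\<^sup>\<gamma> \<cdot> \<omega>\<close> for \<open>\<gamma> < \<beta>\<close>.\<close>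

function omega_exp :: "'o ordinal \<Rightarrow> 'o ordinal" where
  "omega_exp \<beta> = (LEAST \<delta>. 1 \<le> \<delta> \<and> (\<forall>\<gamma><\<beta>. omega_exp \<gamma> * omega \<le> \<delta>))"
  by pat_completeness auto
termination
  by (relation "{(x, y). x < y}", rule wf, simp_all)
declare omega_exp.simps [simp del]

text \<open>
  \<open>ord_enum S \<beta>\<close> is the \<open>(\<beta>+1)\<close>-th element of \<open>S\<close> in increasing order; in particular
  \<open>ord_enum S 0\<close> is the first.
\<close>

function ord_enum :: "'o ordinal set \<Rightarrow> 'o ordinal \<Rightarrow> 'o ordinal" where
  "ord_enum S \<beta> = (LEAST \<delta>. \<delta> \<in> S \<and> (\<forall>\<gamma><\<beta>. ord_enum S \<gamma> < \<delta>))"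
  by pat_completeness auto
termination
  by (relation "inv_image {(x, y). x < y} snd", rule wf_inv_image[OF wf], simp_all)
declare ord_enum.simps [simp del]

function veblen :: "'o ordinal \<Rightarrow> 'o ordinal \<Rightarrow> 'o ordinal" where
  "veblen \<alpha> \<beta> =
    (if \<alpha> = 0 then omega_exp \<beta> else ord_enum {\<xi>. \<forall>\<gamma><\<alpha>. veblen \<gamma> \<xi> = \<xi>} \<beta>)"
  by pat_completeness auto
termination
  by (relation "inv_image {(x, y). x < y} fst", rule wf_inv_image[OF wf], simp_all)
declare veblen.simps [simp del]


section \<open>Formulas\<close>

text \<open>
  The \<open>h\<close> agents are the elements of a finite linearly ordered type \<open>'i\<close> with \<open>h\<close> elements,
  listed in increasing order as agents \<open>1, \<dots>, h\<close>; since types are nonempty, \<open>h \<ge> 1\<close>. The type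
  \<open>'p\<close> is that of atomic propositions. \<open>CKDual\<close> is the De Morgan dual of common knowledge \<open>CK\<close>.
\<close>

datatype ('i, 'p) fm =
    Pos 'p
  | Neg 'p
  | Or "('i, 'p) fm" "('i, 'p) fm"
  | And "('i, 'p) fm" "('i, 'p) fm"
  | Dia 'i "('i, 'p) fm"
  | Box 'i "('i, 'p) fm"
  | CKDual "('i, 'p) fm"
  | CK "('i, 'p) fm"

primrec neg :: "('i, 'p) fm \<Rightarrow> ('i, 'p) fm" where
  "neg (Pos p) = Neg p"
| "neg (Neg p) = Pos p"
| "neg (Or A B) = And (neg A) (neg B)"
| "neg (And A B) = Or (neg A) (neg B)"
| "neg (Dia i A) = Box i (neg A)"
| "neg (Box i A) = Dia i (neg A)"
| "neg (CKDual A) = CK (neg A)"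
| "neg (CK A) = CKDual (neg A)"

definition agents :: "'i :: {finite, linorder} list" where
  "agents = sorted_list_of_set UNIV"

text \<open>
  Bracketing to the right; only applied to the nonempty list \<open>agents\<close>, so the value on the empty
  list is irrelevant.
\<close>

fun big :: "('a \<Rightarrow> 'a \<Rightarrow> 'a) \<Rightarrow> 'a list \<Rightarrow> 'a" where
  "big f [A] = A"
| "big f (A # B # As) = f A (big f (B # As))"

definition box_all :: "('i :: {finite, linorder}, 'p) fm \<Rightarrow> ('i, 'p) fm" where
  "box_all A = big And (map (\<lambda>i. Box i A) agents)"

definition dia_all :: "('i :: {finite, linorder}, 'p) fm \<Rightarrow> ('i, 'p) fm" where
  "dia_all A = big Or (map (\<lambda>i. Dia i A) agents)"

primrec rk :: "('i, 'p) fm \<Rightarrow> 'o ordinal" where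
  "rk (Pos p) = 0"
| "rk (Neg p) = 0"
| "rk (Or A B) = max (rk A) (rk B) + 1"
| "rk (And A B) = max (rk A) (rk B) + 1"
| "rk (Dia i A) = rk A + 1"
| "rk (Box i A) = rk A + 1"
| "rk (CKDual A) = omega + rk A"
| "rk (CK A) = omega + rk A"


section \<open>Nested sequents and contexts\<close>

datatype ('i, 'p) item =
    Fm "('i, 'p) fm"
  | Boxed 'i "('i, 'p) item multiset"

type_synonym ('i, 'p) sequent = "('i, 'p) item multiset"

text \<open>
  A context is a sequent with exactly one hole, not inside a formula: \<open>Here \<Gamma>\<close> is \<open>\<Gamma>, { }\<close> and
  \<open>Under \<Gamma> i C\<close> is \<open>\<Gamma>, [C]\<^sub>i\<close>.
\<close>

datatype ('i, 'p) ctxt =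
    Here "('i, 'p) sequent"
  | Under "('i, 'p) sequent" 'i "('i, 'p) ctxt"

primrec fill :: "('i, 'p) ctxt \<Rightarrow> ('i, 'p) sequent \<Rightarrow> ('i, 'p) sequent" where
  "fill (Here \<Gamma>) \<Delta> = \<Gamma> + \<Delta>"
| "fill (Under \<Gamma> i C) \<Delta> = add_mset (Boxed i (fill C \<Delta>)) \<Gamma>"


section \<open>The infinitary system and its proofs\<close>

text \<open>
  Trees labelled with sequents, whose nodes have no, one, two or \<open>\<omega>\<close> many children (these are the
  arities of the rules below). Being elements of a datatype, they are well-founded.
\<close>

datatype ('i, 'p) ptree =
    Leaf "('i, 'p) sequent"
  | Unary "('i, 'p) sequent" "('i, 'p) ptree"
  | Binary "('i, 'p) sequent" "('i, 'p) ptree" "('i, 'p) ptree"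
  | Infinitary "('i, 'p) sequent" "nat \<Rightarrow> ('i, 'p) ptree"

primrec concl :: "('i, 'p) ptree \<Rightarrow> ('i, 'p) sequent" where
  "concl (Leaf \<Gamma>) = \<Gamma>"
| "concl (Unary \<Gamma> t) = \<Gamma>"
| "concl (Binary \<Gamma> t u) = \<Gamma>"
| "concl (Infinitary \<Gamma> f) = \<Gamma>"

primrec depth :: "('i, 'p) ptree \<Rightarrow> 'o ordinal" where
  "depth (Leaf \<Gamma>) = lsub {}"
| "depth (Unary \<Gamma> t) = lsub {depth t}"
| "depth (Binary \<Gamma> t u) = lsub {depth t, depth u}"
| "depth (Infinitary \<Gamma> f) = lsub (range (\<lambda>k. depth (f k)))"

text \<open>
  \<open>is_proof \<gamma> t\<close>: \<open>t\<close> is a proof in the system extended by cuts of rank below \<open>\<gamma>\<close>. The premises of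
  the rule for \<open>CK\<close> are indexed from \<open>0\<close>, hence the exponent \<open>Suc k\<close>.
\<close>

inductive is_proof :: "'o ordinal \<Rightarrow> ('i :: {finite, linorder}, 'p) ptree \<Rightarrow> bool"
  for \<gamma> :: "'o ordinal" where
  ax: "is_proof \<gamma> (Leaf (fill C {#Fm (Pos p), Fm (Neg p)#}))"
| conj: "is_proof \<gamma> t \<Longrightarrow> concl t = fill C {#Fm A#} \<Longrightarrow>
    is_proof \<gamma> u \<Longrightarrow> concl u = fill C {#Fm B#} \<Longrightarrow>
    is_proof \<gamma> (Binary (fill C {#Fm (And A B)#}) t u)"
| disj: "is_proof \<gamma> t \<Longrightarrow> concl t = fill C {#Fm A, Fm B#} \<Longrightarrow>
    is_proof \<gamma> (Unary (fill C {#Fm (Or A B)#}) t)"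
| box: "is_proof \<gamma> t \<Longrightarrow> concl t = fill C {#Boxed i {#Fm A#}#} \<Longrightarrow>
    is_proof \<gamma> (Unary (fill C {#Fm (Box i A)#}) t)"
| dia: "is_proof \<gamma> t \<Longrightarrow> concl t = fill C {#Fm (Dia i A), Boxed i (\<Delta> + {#Fm A#})#} \<Longrightarrow>
    is_proof \<gamma> (Unary (fill C {#Fm (Dia i A), Boxed i \<Delta>#}) t)"
| ck: "(\<And>k. is_proof \<gamma> (f k)) \<Longrightarrow>
    (\<And>k. concl (f k) = fill C {#Fm ((box_all ^^ Suc k) A)#}) \<Longrightarrow>
    is_proof \<gamma> (Infinitary (fill C {#Fm (CK A)#}) f)"
| ckdual: "is_proof \<gamma> t \<Longrightarrow> k \<ge> 1 \<Longrightarrow>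
    concl t = fill C {#Fm (CKDual A), Fm ((dia_all ^^ k) A)#} \<Longrightarrow>
    is_proof \<gamma> (Unary (fill C {#Fm (CKDual A)#}) t)"
| cut: "is_proof \<gamma> t \<Longrightarrow> concl t = fill C {#Fm A#} \<Longrightarrow>
    is_proof \<gamma> u \<Longrightarrow> concl u = fill C {#Fm (neg A)#} \<Longrightarrow>
    rk A < \<gamma> \<Longrightarrow>
    is_proof \<gamma> (Binary (fill C {#}) t u)"

definition derivable ::
    "'o ordinal \<Rightarrow> 'o ordinal \<Rightarrow> ('i :: {finite, linorder}, 'p) sequent \<Rightarrow> bool"
    ("D\<^sub>C \<turnstile>'(_, _') _" [0, 0, 61] 60) where
  "D\<^sub>C \<turnstile>(\<alpha>, \<gamma>) \<Gamma> \<longleftrightarrow> (\<exists>t. is_proof \<gamma> t \<and> concl t = \<Gamma> \<and> depth t \<le> \<alpha>)"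

end

theory Submission
  imports Defs
begin

text \<open>
  Nested sequents are read as labelled trees, and cuts are eliminated in a labelled calculus on
  sets of formulas in which every rule keeps its principal formula. One preservation property
  along covering maps (\<open>lder_sim\<close>) replaces weakening, contraction, inversion and merging of boxes.
  A cut of rank \<open>\<gamma>\<close> between derivations of depth \<open>\<alpha>\<close> and \<open>\<beta>\<close> is then reduced to cuts
  of smaller rank, at depth about \<open>\<alpha> + \<beta>\<close>, so removing the top rank \<open>\<gamma>\<close> costs \<open>\<xi> \<mapsto> \<omega>\<^sup>\<xi>\<close>.
  The values of \<open>\<phi>\<^sub>1\<close> are closed under \<open>\<xi> \<mapsto> \<omega>\<^sup>\<xi>\<close>, and a single cut of rank below \<open>\<gamma> + \<omega>\<close>
  lies only finitely many ranks above \<open>\<gamma>\<close>; hence an induction on the derivation lowers the cut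
  rank from \<open>\<gamma> + \<omega>\<close> to \<open>\<gamma>\<close> at the cost of \<open>\<phi>\<^sub>1\<close>. Finally, a cut-free labelled derivation is
  turned back into a nested proof of the same depth, because a formula already decomposed in the
  nested sequent covers the copy that the labelled calculus has kept.
\<close>

section \<open>Ordinals\<close>

lemma ordinal_abs_eqI: "(r, s) \<in> ordIso \<Longrightarrow> abs_ordinal r = abs_ordinal s"
  by (rule Quotient_rel_abs[OF Quotient_ordinal])

lemma ordinal_rep_abs: "Well_order r \<Longrightarrow> (rep_ordinal (abs_ordinal r), r) \<in> ordIso"
  by (rule Quotient_rep_abs[OF Quotient_ordinal]) (rule ordIso_reflexive)

lemma abs_ordinal_less:
  assumes "(r, s) \<in> ordLess"
  shows "abs_ordinal r < abs_ordinal s"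
proof -
  have w: "Well_order r" "Well_order s"
    using assms by (auto simp: ordLess_def)
  show ?thesis unfolding less_ordinal.rep_eq
    using assms ordinal_rep_abs[OF w(1)] ordinal_rep_abs[OF w(2)]
    by (meson ordIso_ordLess_trans ordIso_symmetric ordLess_ordIso_trans)
qed

lemma rep_ordinal_well_order: "Well_order (rep_ordinal \<xi>)"
  using Quotient_rep_reflp[OF Quotient_ordinal, of \<xi>] by (auto simp: ordIso_def)

text \<open>Every ordinal below \<beta> is the order type of a proper initial segment of a
  representative of \<beta>, and such a segment is named by one element of \<open>'o\<close>. Hence
  there are at most as many ordinals below \<beta> as elements of \<open>'o\<close>.\<close>

lemma initial_segment_range: "\<exists>g :: 'o \<Rightarrow> 'o ordinal. \<forall>\<gamma><\<beta>. \<gamma> \<in> range g"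
proof -
  let ?r = "rep_ordinal \<beta>"
  let ?g = "\<lambda>x. abs_ordinal (Restr ?r (underS ?r x))"
  have "\<gamma> \<in> range ?g" if "\<gamma> < \<beta>" for \<gamma>
  proof -
    have "(rep_ordinal \<gamma>, ?r) \<in> ordLess"
      using that unfolding less_ordinal.rep_eq .
    then obtain a where "(rep_ordinal \<gamma>, Restr ?r (underS ?r a)) \<in> ordIso"
      unfolding ordLess_iff_ordIso_Restr[OF rep_ordinal_well_order rep_ordinal_well_order] ..
    then have "abs_ordinal (rep_ordinal \<gamma>) = ?g a"
      by (rule ordinal_abs_eqI)
    then have "\<gamma> = ?g a"
      unfolding Quotient_abs_rep[OF Quotient_ordinal] .
    then show ?thesis by (rule range_eqI)
  qed
  then show ?thesis by blast
qed

section \<open>Burali-Forti and the existence of upper bounds\<close>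

lemma strict_mono_ge_id:
  fixes f :: "'a :: wellorder \<Rightarrow> 'a"
  assumes "\<And>x y. x < y \<Longrightarrow> f x < f y"
  shows "x \<le> f x"
proof (induction x rule: less_induct)
  case (less x)
  show ?case
    by (metis assms less less_le_not_le linorder_not_less)
qed

text \<open>
  Burali-Forti: an injection would turn the order of all ordinals into a well-order on \<open>'o\<close>, whose
  order type \<open>\<delta>\<close> would satisfy \<open>\<delta> < \<delta>\<close>.
\<close>

lemma no_injection_ordinal: "\<not> inj (g :: 'o ordinal \<Rightarrow> 'o)"
proof
  assume inj: "inj g"
  let ?W = "{(x, y :: 'o ordinal). x \<le> y}"
  have fld: "Field ?W = UNIV" by (auto simp: Field_def)
  have W: "Well_order ?W"
    unfolding well_order_on_def linear_order_on_def partial_order_on_def preorder_on_def fld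
  proof (intro conjI)
    have "?W - Id = {(x, y). x < y}" by auto
    then show "wf (?W - Id)" by (simp add: wf)
  qed (auto simp: refl_on_def trans_def antisym_def total_on_def)
  let ?R = "\<lambda>\<xi>. Restr ?W (underS ?W \<xi>)"
  \<comment> \<open>Transport along the injection gives an isomorphic order on \<open>'o\<close>,
    which is what \<open>abs_ordinal\<close> accepts.\<close>
  have dir: "(r, dir_image r g) \<in> ordIso" if "Well_order r" for r
    using that inj by (intro dir_image_ordIso) (auto intro: inj_on_subset)
  have transfer: "abs_ordinal (dir_image r g) < abs_ordinal (dir_image s g)"
    if "(r, s) \<in> ordLess" for r s
  proof (rule abs_ordinal_less)
    have "Well_order r" "Well_order s" using that by (auto simp: ordLess_def)
    then show "(dir_image r g, dir_image s g) \<in> ordLess"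
      using that dir by (meson ordIso_ordLess_trans ordIso_symmetric ordLess_ordIso_trans)
  qed
  let ?h = "\<lambda>\<xi>. abs_ordinal (dir_image (?R \<xi>) g)"
  let ?\<delta> = "abs_ordinal (dir_image ?W g)"
  have "?h \<xi> < ?h \<zeta>" if "\<xi> < \<zeta>" for \<xi> \<zeta>
  proof (rule transfer)
    have wo: "wo_rel ?W" using W by (simp add: wo_rel_def)
    have S: "underS ?W x = {..< x}" for x
      by (auto simp: underS_def)
    have "underS ?W \<xi> < underS ?W \<zeta>"
      unfolding S lessThan_strict_subset_iff by (fact that)
    then show "(?R \<xi>, ?R \<zeta>) \<in> ordLess"
      unfolding ofilter_subset_ordLess[OF W wo_rel.underS_ofilter[OF wo] wo_rel.underS_ofilter[OF wo]] .
  qed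
  then have "?\<delta> \<le> ?h ?\<delta>" by (rule strict_mono_ge_id)
  moreover have "?h ?\<delta> < ?\<delta>"
    by (rule transfer) (rule underS_Restr_ordLess[OF W], simp add: fld)
  ultimately show False by simp
qed

text \<open>If the family had no strict bound, the ordinals would be the union of its range and of
  \<open>'o\<close> many proper initial segments. For infinite \<open>'o\<close> that union is no
  larger than \<open>'o\<close>, against \<open>no_injection_ordinal\<close>.\<close>

lemma ordinal_bounded:
  fixes f :: "'o :: infinite \<Rightarrow> 'o ordinal"
  shows "\<exists>\<delta>. \<forall>x. f x < \<delta>"
proof (rule ccontr)
  let ?B = "UNIV :: 'o set"
  assume "\<not> ?thesis"
  then have "\<forall>\<delta>. \<exists>x. \<delta> \<le> f x"
    by (simp add: not_less)
  then have "\<delta> \<in> (\<Union>x. {..< f x}) \<union> range f" for \<delta>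
    by (metis UN_I UNIV_I UnI1 UnI2 lessThan_iff order_le_less rangeI)
  then have U: "(UNIV :: 'o ordinal set) = (\<Union>x. {..< f x}) \<union> range f"
    by blast
  have inf: "\<not> finite ?B" by (rule infinite_UNIV)
  have "(card_of {..< f x}, card_of ?B) \<in> ordLeq" for x
  proof -
    obtain g :: "'o \<Rightarrow> 'o ordinal" where "\<forall>\<gamma><f x. \<gamma> \<in> range g"
      using initial_segment_range by blast
    then have "{..< f x} \<subseteq> range g" by auto
    then show ?thesis
      by (meson card_of_image card_of_mono1 ordLeq_transitive)
  qed
  then have "(card_of (\<Union>x. {..< f x}), card_of ?B) \<in> ordLeq"
    by (intro card_of_UNION_ordLeq_infinite[OF inf]) (auto simp: card_of_mono1)
  moreover have "(card_of (range f), card_of ?B) \<in> ordLeq"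
    by (rule card_of_image)
  ultimately have "(card_of (UNIV :: 'o ordinal set), card_of ?B) \<in> ordLeq"
    unfolding U
    by (rule card_of_Un_ordLeq_infinite_Field[OF _ _ _ card_of_Card_order, rotated])
      (simp add: inf Field_card_of)
  then have "\<exists>g :: 'o ordinal \<Rightarrow> 'o. inj g"
    unfolding card_of_ordLeq[symmetric] by blast
  then show False
    by (simp add: no_injection_ordinal)
qed

text \<open>This supplies the upper bounds that make each \<open>LEAST\<close> in the recursive
  definitions well defined.\<close>

lemma ordinal_bounded_segment:
  fixes F :: "'o :: infinite ordinal \<Rightarrow> 'o ordinal"
  shows "\<exists>\<delta>. \<forall>\<gamma><\<beta>. F \<gamma> < \<delta>"
proof -
  obtain g :: "'o \<Rightarrow> 'o ordinal" where g: "\<forall>\<gamma><\<beta>. \<gamma> \<in> range g"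
    using initial_segment_range by blast
  obtain \<delta> where \<delta>: "\<forall>x. F (g x) < \<delta>"
    using ordinal_bounded[of "F \<circ> g"] by auto
  have "F \<gamma> < \<delta>" if \<gamma>: "\<gamma> < \<beta>" for \<gamma>
  proof -
    obtain x where "\<gamma> = g x" using g \<gamma> by blast
    with \<delta> show ?thesis by simp
  qed
  then show ?thesis by blast
qed

lemma ordinal_bounded_nat:
  fixes f :: "nat \<Rightarrow> 'o :: infinite ordinal"
  shows "\<exists>\<delta>. \<forall>n. f n < \<delta>"
proof -
  obtain e :: "nat \<Rightarrow> 'o" where e: "inj e"
    using infinite_UNIV infinite_countable_subset by blast
  obtain \<delta> where "\<forall>x. f (inv e x) < \<delta>"
    using ordinal_bounded[of "f \<circ> inv e"] by auto
  then have "f (inv e (e n)) < \<delta>" for n ..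
  then show ?thesis unfolding inv_f_f[OF e] by blast
qed

lemma ordinal_bounded_two:
  fixes \<alpha> \<beta> :: "'o :: infinite ordinal"
  shows "\<exists>\<delta>. \<alpha> < \<delta> \<and> \<beta> < \<delta>"
  using ordinal_bounded_nat[of "\<lambda>n. if n = 0 then \<alpha> else \<beta>"] by (metis zero_neq_one)

section \<open>Strict suprema, zero and one\<close>

lemma lsub_upper:
  "\<exists>\<delta>. \<forall>\<xi>\<in>X. \<xi> < \<delta> \<Longrightarrow> \<xi> \<in> X \<Longrightarrow> \<xi> < lsub X"
  unfolding lsub_def by (rule LeastI2_ex) auto

lemma lsub_least: "(\<And>\<xi>. \<xi> \<in> X \<Longrightarrow> \<xi> < \<delta>) \<Longrightarrow> lsub X \<le> \<delta>"
  unfolding lsub_def by (rule Least_le) auto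

lemma lsub_range_upper:
  fixes f :: "nat \<Rightarrow> 'o :: infinite ordinal"
  shows "f n < lsub (range f)"
  by (rule lsub_upper) (use ordinal_bounded_nat[of f] in auto)

lemma lsub_two_upper:
  fixes \<alpha> \<beta> :: "'o :: infinite ordinal"
  shows "\<alpha> < lsub {\<alpha>, \<beta>}" "\<beta> < lsub {\<alpha>, \<beta>}"
  by (rule lsub_upper; use ordinal_bounded_two[of \<alpha> \<beta>] in auto)+

lemma ordinal_zero_le [simp]: "(0 :: 'o ordinal) \<le> x"
  unfolding zero_ordinal_def by (rule lsub_least) simp

lemma ordinal_not_less_zero [simp]: "\<not> (x :: 'o ordinal) < 0"
  by (simp add: not_less)

lemma ordinal_le_zero [simp]: "(x :: 'o ordinal) \<le> 0 \<longleftrightarrow> x = 0"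
  by (simp add: order.eq_iff)

lemma ordinal_less_one [simp]:
  fixes x :: "'o :: infinite ordinal"
  shows "x < 1 \<longleftrightarrow> x = 0"
proof
  show "x < 1" if "x = 0"
    using that lsub_two_upper(1)[of 0 0] by (simp add: one_ordinal_def)
  show "x = 0" if "x < 1"
  proof (rule ccontr)
    assume "x \<noteq> 0"
    then have "0 < x" by (simp add: less_le)
    then have "1 \<le> x" unfolding one_ordinal_def by (intro lsub_least) simp
    with that show False by simp
  qed
qed

section \<open>Ordinal addition\<close>

text \<open>\<open>LEAST\<close> meets its defining condition only if some ordinal does; a bound of
  the earlier values, joined with \<alpha> by \<open>max\<close>, is such an ordinal.\<close>

lemma ord_add_props:
  fixes \<alpha> \<beta> :: "'o :: infinite ordinal"
  shows "\<alpha> \<le> \<alpha> + \<beta> \<and> (\<forall>\<gamma><\<beta>. \<alpha> + \<gamma> < \<alpha> + \<beta>)"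
  unfolding plus_ordinal_def ord_add.simps[of \<alpha> \<beta>]
proof (rule LeastI_ex)
  obtain \<delta> where \<delta>: "\<forall>\<gamma><\<beta>. ord_add \<alpha> \<gamma> < \<delta>"
    using ordinal_bounded_segment by blast
  have "\<alpha> \<le> max \<alpha> \<delta> \<and> (\<forall>\<gamma><\<beta>. ord_add \<alpha> \<gamma> < max \<alpha> \<delta>)"
    using \<delta> by (auto simp: less_max_iff_disj)
  then show "\<exists>\<delta>. \<alpha> \<le> \<delta> \<and> (\<forall>\<gamma><\<beta>. ord_add \<alpha> \<gamma> < \<delta>)" ..
qed

lemma ord_add_ge_left [simp]: "(\<alpha> :: 'o :: infinite ordinal) \<le> \<alpha> + \<beta>"
  using ord_add_props by blast

lemma ord_add_strict_mono: "\<gamma> < \<beta> \<Longrightarrow> (\<alpha> :: 'o :: infinite ordinal) + \<gamma> < \<alpha> + \<beta>"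
  using ord_add_props by blast

lemma ord_add_mono_right: "\<gamma> \<le> \<beta> \<Longrightarrow> (\<alpha> :: 'o :: infinite ordinal) + \<gamma> \<le> \<alpha> + \<beta>"
  using ord_add_strict_mono by (metis order_le_less)

lemma ord_add_least:
  fixes \<alpha> \<beta> :: "'o :: infinite ordinal"
  assumes "\<alpha> \<le> \<delta>" "\<And>\<gamma>. \<gamma> < \<beta> \<Longrightarrow> \<alpha> + \<gamma> < \<delta>"
  shows "\<alpha> + \<beta> \<le> \<delta>"
  using assms unfolding plus_ordinal_def ord_add.simps[of \<alpha> \<beta>] by (intro Least_le) auto

lemma ord_add_mono_left:
  fixes \<alpha> \<beta> :: "'o :: infinite ordinal"
  assumes "\<alpha> \<le> \<alpha>'"
  shows "\<alpha> + \<beta> \<le> \<alpha>' + \<beta>"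
proof (induction \<beta> rule: less_induct)
  case (less \<beta>)
  show ?case
  proof (rule ord_add_least)
    show "\<alpha> \<le> \<alpha>' + \<beta>" using assms by (rule order_trans) simp
    show "\<alpha> + \<gamma> < \<alpha>' + \<beta>" if "\<gamma> < \<beta>" for \<gamma>
      using less[OF that] ord_add_strict_mono[OF that] by (rule order_le_less_trans)
  qed
qed

lemma ord_add_mono:
  "\<alpha> \<le> \<alpha>' \<Longrightarrow> \<beta> \<le> \<beta>' \<Longrightarrow> (\<alpha> :: 'o :: infinite ordinal) + \<beta> \<le> \<alpha>' + \<beta>'"
  by (meson ord_add_mono_left ord_add_mono_right order_trans)

lemma ord_add_ge_right: "(\<beta> :: 'o :: infinite ordinal) \<le> \<alpha> + \<beta>"
  by (rule strict_mono_ge_id) (rule ord_add_strict_mono)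

lemma ord_add_zero_right [simp]: "(\<alpha> :: 'o :: infinite ordinal) + 0 = \<alpha>"
  by (rule antisym) (rule ord_add_least, auto)

lemma ord_add_zero_left [simp]: "0 + (\<alpha> :: 'o :: infinite ordinal) = \<alpha>"
proof (induction \<alpha> rule: less_induct)
  case (less \<alpha>)
  show ?case
    by (rule antisym) (auto simp: less intro: ord_add_least ord_add_ge_right)
qed

lemma less_ord_add_one [simp]: "\<xi> < (\<alpha> :: 'o :: infinite ordinal) + 1 \<longleftrightarrow> \<xi> \<le> \<alpha>"
proof
  show "\<xi> < \<alpha> + 1" if "\<xi> \<le> \<alpha>"
    using that ord_add_strict_mono[of 0 1 \<alpha>] by simp
  show "\<xi> \<le> \<alpha>" if "\<xi> < \<alpha> + 1"
  proof (rule ccontr)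
    assume "\<not> \<xi> \<le> \<alpha>"
    then have "\<alpha> + 1 \<le> \<xi>" by (intro ord_add_least) auto
    with that show False by simp
  qed
qed

lemma ord_add_one_le_iff: "(\<alpha> :: 'o :: infinite ordinal) + 1 \<le> \<xi> \<longleftrightarrow> \<alpha> < \<xi>"
  using less_ord_add_one[of \<xi> \<alpha>] by (metis not_le)

lemma ord_add_succ: "(\<alpha> :: 'o :: infinite ordinal) + (\<beta> + 1) = (\<alpha> + \<beta>) + 1"
proof (rule antisym)
  show "\<alpha> + (\<beta> + 1) \<le> (\<alpha> + \<beta>) + 1"
    by (rule ord_add_least) (auto intro: ord_add_mono_right order_less_imp_le)
  show "(\<alpha> + \<beta>) + 1 \<le> \<alpha> + (\<beta> + 1)"
    by (simp add: ord_add_one_le_iff ord_add_strict_mono)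
qed

lemma ord_add_assoc_le: "(\<alpha> + \<beta>) + \<gamma> \<le> (\<alpha> :: 'o :: infinite ordinal) + (\<beta> + \<gamma>)"
proof (induction \<gamma> rule: less_induct)
  case (less \<gamma>)
  show ?case
  proof (rule ord_add_least)
    fix \<xi> assume "\<xi> < \<gamma>"
    then show "\<alpha> + \<beta> + \<xi> < \<alpha> + (\<beta> + \<gamma>)"
      by (metis less ord_add_strict_mono order_le_less_trans)
  qed (simp add: ord_add_mono_right)
qed

section \<open>Multiplication and finite ordinals\<close>

lemma ord_mult_step:
  fixes \<alpha> \<beta> :: "'o :: infinite ordinal"
  assumes "\<gamma> < \<beta>"
  shows "\<alpha> * \<gamma> + \<alpha> \<le> \<alpha> * \<beta>"
proof -
  obtain \<delta> where "\<forall>\<gamma><\<beta>. ord_add (ord_mult \<alpha> \<gamma>) \<alpha> < \<delta>"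
    using ordinal_bounded_segment[of \<beta> "\<lambda>\<gamma>. ord_add (ord_mult \<alpha> \<gamma>) \<alpha>"] by blast
  then have "\<exists>\<delta>. \<forall>\<gamma><\<beta>. ord_add (ord_mult \<alpha> \<gamma>) \<alpha> \<le> \<delta>"
    by (meson order_less_imp_le)
  then have "\<forall>\<gamma><\<beta>. ord_add (ord_mult \<alpha> \<gamma>) \<alpha> \<le> ord_mult \<alpha> \<beta>"
    unfolding ord_mult.simps[of \<alpha> \<beta>] by (rule LeastI_ex)
  then show ?thesis using assms by (simp add: times_ordinal_def plus_ordinal_def)
qed

lemma ord_mult_least:
  fixes \<alpha> \<beta> :: "'o :: infinite ordinal"
  assumes "\<And>\<gamma>. \<gamma> < \<beta> \<Longrightarrow> \<alpha> * \<gamma> + \<alpha> \<le> \<delta>"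
  shows "\<alpha> * \<beta> \<le> \<delta>"
  using assms unfolding times_ordinal_def plus_ordinal_def ord_mult.simps[of \<alpha> \<beta>]
  by (intro Least_le) auto

lemma ord_mult_zero [simp]: "(\<alpha> :: 'o :: infinite ordinal) * 0 = 0"
  using ord_mult_least[of 0 \<alpha> 0] by simp

lemma ord_mult_succ: "(\<alpha> :: 'o :: infinite ordinal) * (\<beta> + 1) = \<alpha> * \<beta> + \<alpha>"
proof (rule antisym)
  have mono: "\<alpha> * \<gamma> \<le> \<alpha> * \<beta>" if "\<gamma> \<le> \<beta>" for \<gamma>
    using that ord_mult_step[of \<gamma> \<beta> \<alpha>] ord_add_ge_left[of "\<alpha> * \<gamma>" \<alpha>]
    by (metis order_le_less order_trans)
  show "\<alpha> * (\<beta> + 1) \<le> \<alpha> * \<beta> + \<alpha>"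
    by (rule ord_mult_least) (simp add: ord_add_mono_left mono)
qed (simp add: ord_mult_step)

lemma ord_of_nat_less_omega [simp]: "ord_of_nat n < (omega :: 'o :: infinite ordinal)"
  unfolding omega_def by (rule lsub_range_upper)

lemma less_omegaD: "\<xi> < omega \<Longrightarrow> \<exists>n. \<xi> \<le> ord_of_nat n"
  by (metis lsub_least not_le omega_def order_less_imp_le rangeE)

text \<open>An ordinal not below any \<alpha> + k exceeds \<alpha> + \<gamma> for all \<gamma> below
  \<open>omega\<close>, so it is at least \<alpha> + omega. For a single cut this gives the finite
  distance k of its rank from \<alpha>.\<close>

lemma less_add_omegaD:
  fixes \<xi> \<alpha> :: "'o :: infinite ordinal"
  assumes "\<xi> < \<alpha> + omega"
  shows "\<exists>k. \<xi> < \<alpha> + ord_of_nat k"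
proof (rule ccontr)
  assume neg: "\<not> ?thesis"
  then have "\<alpha> \<le> \<xi>"
    by (metis ord_add_zero_right ord_of_nat.simps(1) not_le)
  moreover have "\<alpha> + \<gamma> < \<xi>" if \<gamma>: "\<gamma> < omega" for \<gamma>
  proof -
    obtain n where "\<gamma> \<le> ord_of_nat n" using less_omegaD[OF \<gamma>] by blast
    then have "\<gamma> < ord_of_nat (Suc n)" by simp
    then show ?thesis
      using neg ord_add_strict_mono by (metis not_le order_less_le_trans)
  qed
  ultimately have "\<alpha> + omega \<le> \<xi>" by (rule ord_add_least)
  with assms show False by simp
qed

lemma ord_mult_one [simp]: "(\<alpha> :: 'o :: infinite ordinal) * 1 = \<alpha>"
  using ord_mult_succ[of \<alpha> 0] by simp

section \<open>Powers of omega and their fixpoints\<close>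

lemma omega_exp_props:
  fixes \<beta> :: "'o :: infinite ordinal"
  shows "1 \<le> omega_exp \<beta> \<and> (\<forall>\<gamma><\<beta>. omega_exp \<gamma> * omega \<le> omega_exp \<beta>)"
  unfolding omega_exp.simps[of \<beta>]
proof (rule LeastI_ex)
  obtain \<delta> where \<delta>: "\<forall>\<gamma><\<beta>. omega_exp \<gamma> * omega < \<delta>"
    using ordinal_bounded_segment[of \<beta> "\<lambda>\<gamma>. omega_exp \<gamma> * omega"] by blast
  have "1 \<le> max 1 \<delta> \<and> (\<forall>\<gamma><\<beta>. omega_exp \<gamma> * omega \<le> max 1 \<delta>)"
    using \<delta> by (auto simp: le_max_iff_disj)
  then show "\<exists>\<delta>. 1 \<le> \<delta> \<and> (\<forall>\<gamma><\<beta>. omega_exp \<gamma> * omega \<le> \<delta>)" ..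
qed

lemma omega_exp_ge_one: "1 \<le> omega_exp (\<beta> :: 'o :: infinite ordinal)"
  using omega_exp_props by blast

lemma omega_exp_least:
  assumes "1 \<le> \<delta>" "\<And>\<gamma>. \<gamma> < \<beta> \<Longrightarrow> omega_exp \<gamma> * omega \<le> \<delta>"
  shows "omega_exp \<beta> \<le> \<delta>"
  using assms unfolding omega_exp.simps[of \<beta>] by (intro Least_le) auto

text \<open>Strictness comes from one spare summand \<open>omega_exp \<gamma>\<close>, which is at
  least 1 and still fits below \<open>omega_exp \<gamma> * omega\<close>.\<close>

lemma omega_exp_mult_less:
  fixes \<beta> :: "'o :: infinite ordinal"
  assumes "\<gamma> < \<beta>"
  shows "omega_exp \<gamma> * ord_of_nat n < omega_exp \<beta>"
proof -
  have "omega_exp \<gamma> * ord_of_nat n < omega_exp \<gamma> * ord_of_nat n + 1" by simp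
  also have "\<dots> \<le> omega_exp \<gamma> * ord_of_nat n + omega_exp \<gamma>"
    by (rule ord_add_mono_right) (rule omega_exp_ge_one)
  also have "\<dots> \<le> omega_exp \<gamma> * omega" by (rule ord_mult_step) simp
  also have "\<dots> \<le> omega_exp \<beta>" using assms omega_exp_props by blast
  finally show ?thesis .
qed

lemma omega_exp_strict_mono:
  fixes \<beta> :: "'o :: infinite ordinal"
  assumes "\<gamma> < \<beta>"
  shows "omega_exp \<gamma> < omega_exp \<beta>"
  using omega_exp_mult_less[OF assms, of 1]
  by (simp add: ord_mult_succ)

lemma omega_exp_mono: "\<gamma> \<le> \<beta> \<Longrightarrow> omega_exp \<gamma> \<le> omega_exp (\<beta> :: 'o :: infinite ordinal)"
  using omega_exp_strict_mono by (metis order_le_less)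

lemma omega_exp_ge: "\<beta> \<le> omega_exp (\<beta> :: 'o :: infinite ordinal)"
  by (rule strict_mono_ge_id) (rule omega_exp_strict_mono)

text \<open>The left-hand side is the depth that \<open>lder_reduction\<close> demands for premises
  of depths \<open>omega_exp \<xi>\<close> and \<open>omega_exp \<zeta>\<close>, including the two
  steps of a propositional cut.\<close>

lemma omega_exp_sum_less:
  fixes \<beta> :: "'o :: infinite ordinal"
  assumes "\<xi> < \<beta>" "\<zeta> < \<beta>"
  shows "omega_exp \<xi> + omega_exp \<zeta> + 1 + 1 < omega_exp \<beta>"
proof -
  let ?m = "omega_exp (max \<xi> \<zeta>)"
  \<comment> \<open>Each of the four summands is at most \<open>?m\<close>, as powers are at least
    1; hence the factor 4 below.\<close>
  have "omega_exp \<xi> + omega_exp \<zeta> + 1 + 1 \<le> ?m + ?m + ?m + ?m"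
    by (rule ord_add_mono ord_add_mono omega_exp_mono omega_exp_ge_one max.cobounded1 max.cobounded2)+
  also have "\<dots> = ?m * ord_of_nat (Suc (Suc (Suc (Suc 0))))"
    by (simp add: ord_mult_succ)
  also have "\<dots> < omega_exp \<beta>" by (rule omega_exp_mult_less) (use assms in auto)
  finally show ?thesis .
qed

lemma omega_exp_fixpoint_exists:
  fixes \<delta> :: "'o :: infinite ordinal"
  shows "\<exists>\<epsilon>\<ge>\<delta>. omega_exp \<epsilon> = \<epsilon>"
proof -
  \<comment> \<open>The fixpoint is the supremum of the iterates. Starting from at least 1 meets the
    first requirement of \<open>omega_exp_least\<close>.\<close>
  define x where "x k = (omega_exp ^^ k) (max 1 \<delta>)" for k
  define \<epsilon> where "\<epsilon> = (LEAST \<epsilon>. \<forall>k. x k \<le> \<epsilon>)"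
  have "\<exists>\<epsilon>. \<forall>k. x k \<le> \<epsilon>"
    using ordinal_bounded_nat[of x] by (meson order_less_imp_le)
  then have up: "x k \<le> \<epsilon>" for k
    unfolding \<epsilon>_def using LeastI_ex[of "\<lambda>\<epsilon>. \<forall>k. x k \<le> \<epsilon>"] by blast
  have "omega_exp \<epsilon> \<le> \<epsilon>"
  proof (rule omega_exp_least)
    have "max 1 \<delta> \<le> \<epsilon>" using up[of 0] by (simp add: x_def)
    then show "1 \<le> \<epsilon>" by simp
    fix \<gamma> assume "\<gamma> < \<epsilon>"
    \<comment> \<open>Minimality of \<epsilon> puts some iterate above \<gamma>; the next iterate
      then absorbs the factor \<open>omega\<close>.\<close>
    then have "\<exists>k. \<gamma> < x k"
      unfolding \<epsilon>_def using not_less_Least not_le by blast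
    then obtain k where "\<gamma> < x k" ..
    then have "omega_exp \<gamma> * omega \<le> omega_exp (x k)"
      using omega_exp_props by blast
    also have "\<dots> \<le> \<epsilon>" using up[of "Suc k"] by (simp add: x_def)
    finally show "omega_exp \<gamma> * omega \<le> \<epsilon>" .
  qed
  moreover have "\<delta> \<le> \<epsilon>" using up[of 0] by (simp add: x_def)
  ultimately show ?thesis using omega_exp_ge by (blast intro: antisym)
qed

section \<open>The Veblen function at first argument 1\<close>

text \<open>Only 0 lies below 1, so the common fixpoints enumerated here are those of
  \<open>omega_exp\<close>. They are unbounded, so every stage of the enumeration exists.\<close>

lemma veblen_one_props:
  fixes \<beta> :: "'o :: infinite ordinal"
  shows "omega_exp (veblen 1 \<beta>) = veblen 1 \<beta> \<and> (\<forall>\<gamma><\<beta>. veblen 1 \<gamma> < veblen 1 \<beta>)"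
proof -
  let ?S = "{\<xi> :: 'o ordinal. \<forall>\<gamma><1. veblen \<gamma> \<xi> = \<xi>}"
  have S: "?S = {\<xi>. omega_exp \<xi> = \<xi>}"
    by (auto simp: veblen.simps[of 0])
  have "(1 :: 'o ordinal) \<noteq> 0" by (metis ordinal_less_one less_irrefl)
  then have v: "veblen 1 = ord_enum ?S"
    by (auto simp: veblen.simps[of 1])
  have "\<exists>\<delta>. \<delta> \<in> ?S \<and> (\<forall>\<gamma><\<beta>. ord_enum ?S \<gamma> < \<delta>)"
  proof -
    obtain \<delta> where \<delta>: "\<forall>\<gamma><\<beta>. ord_enum ?S \<gamma> < \<delta>"
      using ordinal_bounded_segment[of \<beta> "ord_enum ?S"] by blast
    obtain \<epsilon> where "\<delta> \<le> \<epsilon>" "omega_exp \<epsilon> = \<epsilon>"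
      using omega_exp_fixpoint_exists by blast
    with \<delta> show ?thesis unfolding S by (blast intro: order_less_le_trans)
  qed
  from LeastI_ex[OF this]
  have "ord_enum ?S \<beta> \<in> ?S \<and> (\<forall>\<gamma><\<beta>. ord_enum ?S \<gamma> < ord_enum ?S \<beta>)"
    unfolding ord_enum.simps[of ?S \<beta>, symmetric] .
  then show ?thesis unfolding v S by blast
qed

lemma veblen_one_strict_mono:
  "\<gamma> < \<beta> \<Longrightarrow> veblen 1 \<gamma> < veblen 1 (\<beta> :: 'o :: infinite ordinal)"
  using veblen_one_props by blast

lemma iterated_omega_exp_less_veblen_one:
  fixes \<beta> :: "'o :: infinite ordinal"
  assumes "\<xi> < veblen 1 \<beta>"
  shows "(omega_exp ^^ k) \<xi> < veblen 1 \<beta>"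
proof (induction k)
  case (Suc k)
  then show ?case
    using omega_exp_strict_mono veblen_one_props by (metis funpow.simps(2) o_apply)
qed (simp add: assms)

lemma veblen_one_limit:
  fixes \<beta> :: "'o :: infinite ordinal"
  assumes "\<xi> < veblen 1 \<beta>"
  shows "\<xi> + 1 < veblen 1 \<beta>"
proof -
  have "\<xi> + 1 \<le> omega_exp \<xi> + omega_exp \<xi>"
    by (rule ord_add_mono omega_exp_ge omega_exp_ge_one)+
  also have "\<dots> \<le> omega_exp \<xi> + omega_exp \<xi> + 1 + 1"
    by (rule order_trans[OF ord_add_ge_left ord_add_ge_left])
  also have "\<dots> < omega_exp (veblen 1 \<beta>)" using assms assms by (rule omega_exp_sum_less)
  also have "\<dots> = veblen 1 \<beta>" using veblen_one_props by blast
  finally show ?thesis .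
qed

section \<open>Negation and ranks\<close>

lemma neg_neg [simp]: "neg (neg A) = A"
  by (induction A) simp_all

lemma rk_neg [simp]: "rk (neg A) = rk A"
  by (induction A) simp_all

lemma agents_not_Nil [simp]: "(agents :: 'i :: {finite, linorder} list) \<noteq> []"
  unfolding agents_def by simp

lemma neg_big_And: "xs \<noteq> [] \<Longrightarrow> neg (big And (map f xs)) = big Or (map (\<lambda>x. neg (f x)) xs)"
proof (induction xs rule: list_nonempty_induct)
  case (cons x xs)
  then show ?case by (cases xs) simp_all
qed simp

lemma neg_box_all_power: "neg ((box_all ^^ k) A) = (dia_all ^^ k) (neg A)"
  by (induction k) (simp_all add: box_all_def dia_all_def neg_big_And)

lemma neg_dia_all_power: "neg ((dia_all ^^ k) A) = (box_all ^^ k) (neg A)"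
  by (metis neg_box_all_power neg_neg)

lemma ord_add_one_of_nat:
  "((\<alpha> :: 'o :: infinite ordinal) + 1) + ord_of_nat k = \<alpha> + ord_of_nat (Suc k)"
  by (induction k) (simp_all add: ord_add_succ)

lemma ord_of_nat_add:
  "((\<alpha> :: 'o :: infinite ordinal) + ord_of_nat j) + ord_of_nat k = \<alpha> + ord_of_nat (j + k)"
  by (induction k) (simp_all add: ord_add_succ)

text \<open>The inequality fails for ordinals \<rho> with omega + \<rho> = \<rho>, such as omega
  squared. It is therefore proved along the formula: it is preserved by maximum, successor and
  adding \<open>omega\<close> on the left, the operations that build \<open>rk\<close>.\<close>

lemma rk_add_less_omega_add:
  "(rk A :: 'o :: infinite ordinal) + ord_of_nat k < omega + rk A"
proof -
  \<comment> \<open>The successor on the left is moved into the finite summand, so the assumption on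
    \<rho> must be available for all k.\<close>
  have succ: "(\<rho> + 1) + ord_of_nat k < omega + (\<rho> + 1)"
    if "\<And>k. \<rho> + ord_of_nat k < omega + \<rho>" for \<rho> :: "'o ordinal" and k
    using that[of "Suc k"]
    by (simp only: ord_add_one_of_nat ord_add_succ[of omega] less_ord_add_one order_less_imp_le)
  have omega: "(omega + \<rho>) + ord_of_nat k < omega + (omega + \<rho>)"
    if "\<And>k. \<rho> + ord_of_nat k < omega + \<rho>" for \<rho> :: "'o ordinal" and k
    using ord_add_assoc_le ord_add_strict_mono[OF that] by (rule order_le_less_trans)
  show ?thesis
  proof (induction A arbitrary: k)
    case (Or A B)
    then show ?case unfolding rk.simps by (intro succ) (simp add: max_def)
  next
    case (And A B)
    then show ?case unfolding rk.simps by (intro succ) (simp add: max_def)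
  next
    case (Dia i A)
    then show ?case unfolding rk.simps by (intro succ)
  next
    case (Box i A)
    then show ?case unfolding rk.simps by (intro succ)
  next
    case (CKDual A)
    then show ?case unfolding rk.simps by (intro omega)
  next
    case (CK A)
    then show ?case unfolding rk.simps by (intro omega)
  qed simp_all
qed

lemma rk_big_And:
  "xs \<noteq> [] \<Longrightarrow> (\<And>x. x \<in> set xs \<Longrightarrow> (rk (f x) :: 'o :: infinite ordinal) \<le> \<rho>) \<Longrightarrow>
    \<exists>k. rk (big And (map f xs)) \<le> \<rho> + ord_of_nat k"
proof (induction xs rule: list_nonempty_induct)
  case (single x)
  then show ?case by (metis ord_add_zero_right ord_of_nat.simps(1) big.simps(1) list.simps(8,9) list.set_intros(1))
next
  case (cons x xs)
  then obtain k where k: "rk (big And (map f xs)) \<le> \<rho> + ord_of_nat k" by auto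
  have "rk (f x) \<le> \<rho> + ord_of_nat k"
    using cons.prems[of x] by (simp add: order_trans[OF _ ord_add_ge_left])
  then have "max (rk (f x)) (rk (big And (map f xs))) + 1 \<le> \<rho> + ord_of_nat (Suc k)"
    using k by (simp add: ord_add_succ ord_add_mono_left)
  moreover have "big And (map f (x # xs)) = And (f x) (big And (map f xs))"
    using cons.hyps by (cases xs) simp_all
  ultimately show ?case by (metis rk.simps(4))
qed

lemma rk_box_all_power: "\<exists>j. (rk ((box_all ^^ k) A) :: 'o :: infinite ordinal) \<le> rk A + ord_of_nat j"
proof (induction k)
  case 0
  show ?case by (rule exI[of _ 0]) simp
next
  case (Suc k)
  let ?B = "(box_all ^^ k) A"
  obtain j where j: "(rk ?B :: 'o ordinal) \<le> rk A + ord_of_nat j" using Suc by blast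
  have "\<exists>i. (rk (box_all ?B) :: 'o ordinal) \<le> (rk ?B + 1) + ord_of_nat i"
    unfolding box_all_def by (rule rk_big_And) simp_all
  then obtain i where "(rk (box_all ?B) :: 'o ordinal) \<le> rk ?B + ord_of_nat (Suc i)"
    unfolding ord_add_one_of_nat by blast
  also have "\<dots> \<le> (rk A + ord_of_nat j) + ord_of_nat (Suc i)"
    using j by (rule ord_add_mono_left)
  finally show ?case unfolding ord_of_nat_add funpow.simps o_apply by blast
qed

text \<open>Iterated boxes raise the rank of \<open>A\<close> by a finite amount, whereas
  \<open>CK\<close> adds \<open>omega\<close> on the left. So a cut on \<open>CK A\<close> can be
  traded for a cut of smaller rank on one of the premises of its rule.\<close>

lemma rk_box_all_power_less: "(rk ((box_all ^^ k) A) :: 'o :: infinite ordinal) < rk (CK A)"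
proof -
  obtain j where "(rk ((box_all ^^ k) A) :: 'o ordinal) \<le> rk A + ord_of_nat j"
    using rk_box_all_power by blast
  then show ?thesis using rk_add_less_omega_add by (auto intro: order_le_less_trans)
qed

lemma rk_dia_all_power_less: "(rk ((dia_all ^^ k) A) :: 'o :: infinite ordinal) < rk (CKDual A)"
  using rk_box_all_power_less[of k "neg A"] by (metis neg_dia_all_power rk.simps(7,8) rk_neg)

section \<open>Covering relations between labelled structures\<close>

text \<open>
  A labelled structure is given by the formulas \<open>h\<close> at its labels and its edges \<open>e\<close>. A formula is
  covered at a label if it is present or has been decomposed by its rule in \<open>D\<^sub>C\<close>; the
  decomposition need not reach atoms. \<open>Dia\<close> and \<open>CKDual\<close> have no clause because their rules keep
  the principal formula.
\<close>

inductive cov :: "('l \<Rightarrow> ('i :: {finite, linorder}, 'p) fm \<Rightarrow> bool) \<Rightarrow> ('l \<Rightarrow> 'i \<Rightarrow> 'l \<Rightarrow> bool) \<Rightarrow>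
    'l \<Rightarrow> ('i, 'p) fm \<Rightarrow> bool"
  for h e where
  cov_here: "h x A \<Longrightarrow> cov h e x A"
| cov_And1: "cov h e x A \<Longrightarrow> cov h e x (And A B)"
| cov_And2: "cov h e x B \<Longrightarrow> cov h e x (And A B)"
| cov_Or: "cov h e x A \<Longrightarrow> cov h e x B \<Longrightarrow> cov h e x (Or A B)"
| cov_Box: "e x i y \<Longrightarrow> cov h e y A \<Longrightarrow> cov h e x (Box i A)"
| cov_CK: "cov h e x ((box_all ^^ Suc k) A) \<Longrightarrow> cov h e x (CK A)"

inductive_simps cov_simps:
  "cov h e x (Pos p)" "cov h e x (Neg p)" "cov h e x (Dia i A)" "cov h e x (CKDual A)"
  "cov h e x (And A B)" "cov h e x (Or A B)" "cov h e x (Box i A)" "cov h e x (CK A)"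

text \<open>A homomorphism of labelled structures that preserves formulas only up to covering. It
  need not be injective, so labels may be merged.\<close>

definition sim :: "('k \<Rightarrow> 'l) \<Rightarrow> ('k \<Rightarrow> ('i :: {finite, linorder}, 'p) fm \<Rightarrow> bool) \<Rightarrow> ('k \<Rightarrow> 'i \<Rightarrow> 'k \<Rightarrow> bool) \<Rightarrow>
    ('l \<Rightarrow> ('i, 'p) fm \<Rightarrow> bool) \<Rightarrow> ('l \<Rightarrow> 'i \<Rightarrow> 'l \<Rightarrow> bool) \<Rightarrow> bool" where
  "sim f h e h' e' \<longleftrightarrow>
    (\<forall>x A. h x A \<longrightarrow> cov h' e' (f x) A) \<and> (\<forall>x i y. e x i y \<longrightarrow> e' (f x) i (f y))"

lemma simI:
  "(\<And>x A. h x A \<Longrightarrow> cov h' e' (f x) A) \<Longrightarrow> (\<And>x i y. e x i y \<Longrightarrow> e' (f x) i (f y)) \<Longrightarrow>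
    sim f h e h' e'"
  by (simp add: sim_def)

lemma sim_holds: "sim f h e h' e' \<Longrightarrow> h x A \<Longrightarrow> cov h' e' (f x) A"
  by (simp add: sim_def)

lemma sim_edge: "sim f h e h' e' \<Longrightarrow> e x i y \<Longrightarrow> e' (f x) i (f y)"
  by (simp add: sim_def)

text \<open>Covering itself is preserved by covering maps, which is why these maps compose.\<close>

lemma sim_cov: "cov h e x A \<Longrightarrow> sim f h e h' e' \<Longrightarrow> cov h' e' (f x) A"
proof (induction rule: cov.induct)
  case (cov_here x A)
  then show ?case by (simp add: sim_holds)
next
  case (cov_Box x i y A)
  then show ?case by (blast intro: cov.cov_Box sim_edge)
qed (blast intro: cov.intros)+

lemma sim_trans: "sim f h e h' e' \<Longrightarrow> sim g h' e' h'' e'' \<Longrightarrow> sim (\<lambda>x. g (f x)) h e h'' e''"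
  by (rule simI) (blast intro: sim_cov sim_holds sim_edge)+

abbreviation holds :: "('l \<times> ('i, 'p) fm) set \<Rightarrow> 'l \<Rightarrow> ('i, 'p) fm \<Rightarrow> bool" where
  "holds F x A \<equiv> (x, A) \<in> F"

abbreviation arrow :: "('l \<times> 'i \<times> 'l) set \<Rightarrow> 'l \<Rightarrow> 'i \<Rightarrow> 'l \<Rightarrow> bool" where
  "arrow E x i y \<equiv> (x, i, y) \<in> E"

lemma sim_insert:
  "sim f (holds F) e h' e' \<Longrightarrow> cov h' e' (f x) A \<Longrightarrow> sim f (holds (insert (x, A) F)) e h' e'"
  by (auto simp: sim_def)

lemma sim_insert_both:
  assumes "sim f (holds F') (arrow E') (holds F) (arrow E)"
  shows "sim f (holds (insert (x, A) F')) (arrow E') (holds (insert (f x, A) F)) (arrow E)"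
proof (rule sim_insert)
  have "sim (\<lambda>x. x) (holds F) (arrow E) (holds (insert (f x, A) F)) (arrow E)"
    by (rule simI) (auto intro: cov_here)
  with assms show "sim f (holds F') (arrow E') (holds (insert (f x, A) F)) (arrow E)"
    by (rule sim_trans)
qed (auto intro: cov_here)

text \<open>The eigenlabel condition of the box rule.\<close>

definition fresh :: "'l \<Rightarrow> ('l \<times> ('i, 'p) fm) set \<Rightarrow> ('l \<times> 'i \<times> 'l) set \<Rightarrow> bool" where
  "fresh y F E \<longleftrightarrow> (\<forall>A. (y, A) \<notin> F) \<and> (\<forall>x i. (x, i, y) \<notin> E \<and> (y, i, x) \<notin> E)"

lemma fresh_exists:
  assumes "finite F" "finite E"
  shows "\<exists>y :: 'l :: infinite. fresh y F E"
proof -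
  let ?X = "fst ` F \<union> fst ` E \<union> (snd \<circ> snd) ` E"
  obtain y where "y \<notin> ?X"
    using assms ex_new_if_finite[OF infinite_UNIV, of ?X] by auto
  then have "fresh y F E" by (force simp: fresh_def)
  then show ?thesis ..
qed

text \<open>A fresh y may be sent to any suitable successor z without disturbing the rest of the
  map. This serves both when z is newly created and when the box was decomposed before at an
  existing z.\<close>

lemma sim_fresh:
  assumes "sim f (holds F) (arrow E) h' e'" "fresh y F E" "(x, B) \<in> F" "e' (f x) i z" "cov h' e' z A"
  shows "sim (f(y := z)) (holds (insert (y, A) F)) (arrow (insert (x, i, y) E)) h' e'"
proof -
  have "x \<noteq> y" using assms(2,3) by (auto simp: fresh_def)
  then show ?thesis using assms by (auto simp: sim_def fresh_def)
qed

section \<open>Cut elimination in a cumulative labelled calculus\<close>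

text \<open>
  Since every rule keeps its principal formula, sets of labelled formulas suffice and contraction
  is built in. The ordinal \<open>\<alpha>\<close> is an upper bound of the depth.
\<close>

inductive lder :: "'o ordinal \<Rightarrow> 'o ordinal \<Rightarrow> ('l \<times> ('i :: {finite, linorder}, 'p) fm) set \<Rightarrow>
    ('l \<times> 'i \<times> 'l) set \<Rightarrow> bool"
  for \<gamma> :: "'o ordinal" where
  lax: "(x, Pos p) \<in> F \<Longrightarrow> (x, Neg p) \<in> F \<Longrightarrow> lder \<gamma> \<alpha> F E"
| land: "(x, And A B) \<in> F \<Longrightarrow> lder \<gamma> \<alpha>1 (insert (x, A) F) E \<Longrightarrow> \<alpha>1 < \<alpha> \<Longrightarrow>
    lder \<gamma> \<alpha>2 (insert (x, B) F) E \<Longrightarrow> \<alpha>2 < \<alpha> \<Longrightarrow> lder \<gamma> \<alpha> F E"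
| lor: "(x, Or A B) \<in> F \<Longrightarrow> lder \<gamma> \<alpha>1 (insert (x, A) (insert (x, B) F)) E \<Longrightarrow> \<alpha>1 < \<alpha> \<Longrightarrow>
    lder \<gamma> \<alpha> F E"
| lbox: "(x, Box i A) \<in> F \<Longrightarrow> fresh y F E \<Longrightarrow>
    lder \<gamma> \<alpha>1 (insert (y, A) F) (insert (x, i, y) E) \<Longrightarrow> \<alpha>1 < \<alpha> \<Longrightarrow> lder \<gamma> \<alpha> F E"
| ldia: "(x, Dia i A) \<in> F \<Longrightarrow> (x, i, y) \<in> E \<Longrightarrow> lder \<gamma> \<alpha>1 (insert (y, A) F) E \<Longrightarrow> \<alpha>1 < \<alpha> \<Longrightarrow>
    lder \<gamma> \<alpha> F E"
| lck: "(x, CK A) \<in> F \<Longrightarrow> (\<And>k. lder \<gamma> (g k) (insert (x, (box_all ^^ Suc k) A) F) E) \<Longrightarrow>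
    (\<And>k. g k < \<alpha>) \<Longrightarrow> lder \<gamma> \<alpha> F E"
| lckdual: "(x, CKDual A) \<in> F \<Longrightarrow> 1 \<le> k \<Longrightarrow> lder \<gamma> \<alpha>1 (insert (x, (dia_all ^^ k) A) F) E \<Longrightarrow> \<alpha>1 < \<alpha> \<Longrightarrow>
    lder \<gamma> \<alpha> F E"
| lcut: "rk A < \<gamma> \<Longrightarrow> lder \<gamma> \<alpha>1 (insert (x, A) F) E \<Longrightarrow> \<alpha>1 < \<alpha> \<Longrightarrow>
    lder \<gamma> \<alpha>2 (insert (x, neg A) F) E \<Longrightarrow> \<alpha>2 < \<alpha> \<Longrightarrow> lder \<gamma> \<alpha> F E"

section \<open>Structural properties of the labelled calculus\<close>

lemma lder_mono:
  assumes "lder \<gamma> \<alpha> F E" "\<alpha> \<le> \<alpha>'"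
  shows "lder \<gamma> \<alpha>' F E"
  using assms
proof cases
  case lck
  then show ?thesis using assms(2) by (blast intro: lder.lck order_less_le_trans)
qed (blast intro: lder.intros order_less_le_trans)+

lemma lder_rank_mono: "lder \<gamma> \<alpha> F E \<Longrightarrow> \<gamma> \<le> \<gamma>' \<Longrightarrow> lder \<gamma>' \<alpha> F E"
proof (induction rule: lder.induct)
  case (lck x A F g E \<alpha>)
  then show ?case by (blast intro: lder.lck)
qed (blast intro: lder.intros order_less_le_trans)+

text \<open>This one statement provides weakening, merging of labels, and inversion of all rules.\<close>

lemma lder_sim:
  fixes F :: "('l :: infinite \<times> ('i :: {finite, linorder}, 'p) fm) set"
  assumes "lder \<gamma> \<alpha> F' E'" "sim f (holds F') (arrow E') (holds F) (arrow E)" "finite F" "finite E"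
  shows "lder \<gamma> \<alpha> F E"
  using assms
proof (induction arbitrary: f F E rule: lder.induct)
  case (lax x p F' \<alpha> E')
  from sim_holds[OF lax.prems(1) lax.hyps(1)] sim_holds[OF lax.prems(1) lax.hyps(2)]
  show ?case by (auto simp: cov_simps intro: lder.lax)
next
    case (land x A B F' \<alpha>1 E' \<alpha> \<alpha>2)
    note S = land.prems
    from sim_holds[OF S(1) land.hyps(1)] show ?case
      unfolding cov_simps
    proof (elim disjE)
      assume "holds F (f x) (And A B)"
      then show ?case
        using land.IH(1)[OF sim_insert_both[OF S(1)]] land.IH(2)[OF sim_insert_both[OF S(1)]] S land.hyps
        by (auto intro: lder.land)
    next
      \<comment> \<open>The conjunction is already decomposed to its left component, so the rule is
        dropped and the left premise alone suffices.\<close>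
      assume "cov (holds F) (arrow E) (f x) A"
      then have "lder \<gamma> \<alpha>1 F E" using S by (blast intro: land.IH(1) sim_insert)
      then show ?case using \<open>\<alpha>1 < \<alpha>\<close> by (auto intro: lder_mono)
    next
      assume "cov (holds F) (arrow E) (f x) B"
      then have "lder \<gamma> \<alpha>2 F E" using S by (blast intro: land.IH(2) sim_insert)
      then show ?case using \<open>\<alpha>2 < \<alpha>\<close> by (auto intro: lder_mono)
    qed
  next
    case (lor x A B F' \<alpha>1 E' \<alpha>)
    note S = lor.prems
    from sim_holds[OF S(1) lor.hyps(1)] show ?case
      unfolding cov_simps
    proof (elim disjE conjE)
      assume "holds F (f x) (Or A B)"
      then show ?case
        using lor.IH[OF sim_insert_both[OF sim_insert_both[OF S(1)]]] S lor.hyps by (auto intro: lder.lor)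
    next
      assume "cov (holds F) (arrow E) (f x) A" "cov (holds F) (arrow E) (f x) B"
      then have "lder \<gamma> \<alpha>1 F E" using S by (blast intro: lor.IH sim_insert)
      then show ?case using \<open>\<alpha>1 < \<alpha>\<close> by (auto intro: lder_mono)
    qed
  next
    case (lbox x i A F' y E' \<alpha>1 \<alpha>)
    note S = lbox.prems
    from sim_holds[OF S(1) lbox.hyps(1)] show ?case
      unfolding cov_simps
    proof (elim disjE exE conjE)
      assume box: "holds F (f x) (Box i A)"
      \<comment> \<open>The eigenlabel y may occur in the target, so it is renamed to a label fresh
        there.\<close>
      obtain z where z: "fresh z F E" using S fresh_exists by blast
      let ?F = "insert (z, A) F" and ?E = "insert (f x, i, z) E"
      have "sim (\<lambda>x. x) (holds F) (arrow E) (holds ?F) (arrow ?E)"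
        by (rule simI) (auto intro: cov_here)
      from sim_trans[OF S(1) this]
      have "sim (f(y := z)) (holds (insert (y, A) F')) (arrow (insert (x, i, y) E')) (holds ?F) (arrow ?E)"
        by (rule sim_fresh) (use lbox.hyps in \<open>auto intro: cov_here\<close>)
      then have "lder \<gamma> \<alpha>1 ?F ?E" by (rule lbox.IH) (use S in auto)
      with box z show ?case using lbox.hyps by (blast intro: lder.lbox)
    next
      \<comment> \<open>Here the box is already decomposed at an existing successor z, which takes
        the place of the eigenlabel.\<close>
      fix z assume "arrow E (f x) i z" "cov (holds F) (arrow E) z A"
      then have "sim (f(y := z)) (holds (insert (y, A) F')) (arrow (insert (x, i, y) E')) (holds F) (arrow E)"
        using S(1) lbox.hyps by (intro sim_fresh)
      then have "lder \<gamma> \<alpha>1 F E" by (rule lbox.IH) (use S in auto)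
      then show ?case using \<open>\<alpha>1 < \<alpha>\<close> by (auto intro: lder_mono)
    qed
  next
    case (ldia x i A F' y E' \<alpha>1 \<alpha>)
    note S = ldia.prems
    \<comment> \<open>\<open>cov\<close> cannot decompose a diamond, so the formula is present in
      the target and the rule applies again.\<close>
    have "holds F (f x) (Dia i A)" "arrow E (f x) i (f y)"
      using sim_holds[OF S(1) ldia.hyps(1)] sim_edge[OF S(1)] ldia.hyps by (auto simp: cov_simps)
    moreover have "lder \<gamma> \<alpha>1 (insert (f y, A) F) E"
      by (rule ldia.IH[OF sim_insert_both[OF S(1)]]) (use S in auto)
    ultimately show ?case using ldia.hyps by (blast intro: lder.ldia)
  next
    case (lck x A F' g E' \<alpha>)
    note S = lck.prems
    from sim_holds[OF S(1) lck.hyps(1)] show ?case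
      unfolding cov_simps
    proof (elim disjE exE)
      assume "holds F (f x) (CK A)"
      moreover have "lder \<gamma> (g k) (insert (f x, (box_all ^^ Suc k) A) F) E" for k
        by (rule lck.IH[OF sim_insert_both[OF S(1)]]) (use S in auto)
      ultimately show ?case using lck.hyps by (blast intro: lder.lck)
    next
      fix k assume "cov (holds F) (arrow E) (f x) (box_all ((box_all ^^ k) A))"
      then have "cov (holds F) (arrow E) (f x) ((box_all ^^ Suc k) A)" by simp
      then have "lder \<gamma> (g k) F E" using S by (blast intro: lck.IH sim_insert)
      then show ?case using lck.hyps(3)[of k] by (auto intro: lder_mono)
    qed
  next
    case (lckdual x A F' k \<alpha>1 E' \<alpha>)
    note S = lckdual.prems
    have "holds F (f x) (CKDual A)"
      using sim_holds[OF S(1) lckdual.hyps(1)] by (auto simp: cov_simps)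
    moreover have "lder \<gamma> \<alpha>1 (insert (f x, (dia_all ^^ k) A) F) E"
      by (rule lckdual.IH[OF sim_insert_both[OF S(1)]]) (use S in auto)
    ultimately show ?case using lckdual.hyps by (blast intro: lder.lckdual)
  next
    case (lcut A \<alpha>1 x F' E' \<alpha> \<alpha>2)
    note S = lcut.prems
    have "lder \<gamma> \<alpha>1 (insert (f x, A) F) E" "lder \<gamma> \<alpha>2 (insert (f x, neg A) F) E"
      using lcut.IH(1)[OF sim_insert_both[OF S(1)]] lcut.IH(2)[OF sim_insert_both[OF S(1)]] S by auto
    then show ?case using lcut.hyps by (blast intro: lder.lcut)
qed

lemma lder_weaken:
  fixes F :: "('l :: infinite \<times> ('i :: {finite, linorder}, 'p) fm) set"
  assumes "lder \<gamma> \<alpha> F' E'" "F' \<subseteq> F" "E' \<subseteq> E" "finite F" "finite E"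
  shows "lder \<gamma> \<alpha> F E"
  using assms(1) by (rule lder_sim[where f = "\<lambda>x. x"]) (use assms in \<open>auto intro!: simI cov_here\<close>)

text \<open>Inversion in the form used for cut reduction: the formula \<open>A\<close> is given up
  because its components in F' cover it.\<close>

lemma lder_insert_covered:
  fixes F :: "('l :: infinite \<times> ('i :: {finite, linorder}, 'p) fm) set"
  assumes "lder \<gamma> \<alpha> (insert (x, A) F) E" "cov (holds F') (arrow E) x A" "F \<subseteq> F'"
    and "finite F'" "finite E"
  shows "lder \<gamma> \<alpha> F' E"
  using assms(1)
  by (rule lder_sim[where f = "\<lambda>x. x"]) (use assms in \<open>auto intro!: simI intro: cov_here\<close>)

section \<open>Reduction of a single cut\<close>

lemma lder_reduction_aux:
  fixes F :: "('l :: infinite \<times> ('i :: {finite, linorder}, 'p) fm) set"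
    and \<gamma> :: "'o :: infinite ordinal"
  assumes "lder \<gamma> \<beta> F' E'"
    and "\<And>z A. (z, A) \<in> F' \<Longrightarrow> (s z, A) \<in> insert (x, B) F"
    and "\<And>z i y. (z, i, y) \<in> E' \<Longrightarrow> (s z, i, s y) \<in> E"
    and "lder \<gamma> \<alpha> (insert (x, neg B) F) E" "finite F" "finite E"
    and B: "rk B \<le> \<gamma>" "(\<exists>p. B = Pos p \<or> B = Neg p) \<or> (\<exists>i C. B = Dia i C) \<or> (\<exists>C. B = CKDual C)"
  shows "lder \<gamma> (\<alpha> + \<beta>) F E"
  using assms(1-6)
proof (induction arbitrary: s F E rule: lder.induct)
  case (lax z p F' \<beta> E')
  \<comment> \<open>If B is one literal of the axiom, the other literal is \<open>neg B\<close> and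
    lies in F at x, so the derivation of depth \<alpha> already derives F.\<close>
  have "lder \<gamma> \<alpha> F E" if "(x, neg B) \<in> F"
    using that lax.prems by (simp add: insert_absorb)
  moreover have "(x, neg B) \<in> F \<or> (s z, Pos p) \<in> F \<and> (s z, Neg p) \<in> F"
    using lax.prems(1)[OF lax.hyps(1)] lax.prems(1)[OF lax.hyps(2)] by auto
  ultimately show ?case by (auto intro: lder.lax lder_mono)
next
  case (land z C D F' \<beta>1 E' \<beta> \<beta>2)
  have "lder \<gamma> (\<alpha> + \<beta>1) (insert (s z, C) F) E"
    by (rule land.IH(1)[of s]) (use land.prems in \<open>auto intro: lder_weaken\<close>)
  moreover have "lder \<gamma> (\<alpha> + \<beta>2) (insert (s z, D) F) E"
    by (rule land.IH(2)[of s]) (use land.prems in \<open>auto intro: lder_weaken\<close>)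
  moreover have "(s z, And C D) \<in> F" using land.prems(1)[OF land.hyps(1)] B by auto
  ultimately show ?case using land.hyps by (blast intro: lder.land ord_add_strict_mono)
next
  case (lor z C D F' \<beta>1 E' \<beta>)
  have "lder \<gamma> (\<alpha> + \<beta>1) (insert (s z, C) (insert (s z, D) F)) E"
    by (rule lor.IH[of s]) (use lor.prems in \<open>auto intro: lder_weaken\<close>)
  moreover have "(s z, Or C D) \<in> F" using lor.prems(1)[OF lor.hyps(1)] B by auto
  ultimately show ?case using lor.hyps by (blast intro: lder.lor ord_add_strict_mono)
next
  case (lbox z i C F' y E' \<beta>1 \<beta>)
  have box: "(s z, Box i C) \<in> F" using lbox.prems(1)[OF lbox.hyps(1)] B by auto
  \<comment> \<open>y need not be fresh for F and E, so s is redirected at y to a label that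
    is.\<close>
  obtain w where w: "fresh w F E" using lbox.prems fresh_exists by blast
  have "z \<noteq> y" using lbox.hyps by (auto simp: fresh_def)
  have "lder \<gamma> (\<alpha> + \<beta>1) (insert (w, C) F) (insert (s z, i, w) E)"
  proof (rule lbox.IH[of "s(y := w)"])
    show "lder \<gamma> \<alpha> (insert (x, neg B) (insert (w, C) F)) (insert (s z, i, w) E)"
      using lbox.prems(3) by (rule lder_weaken) (use lbox.prems in auto)
  qed (use lbox.prems lbox.hyps(2) \<open>z \<noteq> y\<close> in \<open>auto simp: fresh_def\<close>)
  then show ?case using box w lbox.hyps by (blast intro: lder.lbox ord_add_strict_mono)
next
  case (ldia z i C F' y E' \<beta>1 \<beta>)
  have IH: "lder \<gamma> (\<alpha> + \<beta>1) (insert (s y, C) F) E"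
    by (rule ldia.IH[of s]) (use ldia.prems in \<open>auto intro: lder_weaken\<close>)
  have edge: "(s z, i, s y) \<in> E" using ldia.prems(2)[OF ldia.hyps(2)] .
  have less: "\<alpha> + \<beta>1 < \<alpha> + \<beta>" using ldia.hyps by (blast intro: ord_add_strict_mono)
  then have "\<alpha> < \<alpha> + \<beta>" by (rule order_le_less_trans[OF ord_add_ge_left])
  show ?case
  proof (cases "(s z, Dia i C) \<in> F")
    case True
    then show ?thesis using IH edge less by (blast intro: lder.ldia)
  next
    case False
    then have eq: "s z = x" "B = Dia i C" using ldia.prems(1)[OF ldia.hyps(1)] by auto
    \<comment> \<open>The principal diamond is the cut formula. Its negation is a box, which is
      inverted at the existing successor \<open>s y\<close>; the cut moves to C at that
      label.\<close>
    have "lder \<gamma> \<alpha> (insert (s y, neg C) F) E"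
      by (rule lder_insert_covered[OF ldia.prems(3)])
        (use edge eq ldia.prems in \<open>auto intro: cov_Box cov_here\<close>)
    moreover have "rk C < \<gamma>"
      using B(1) less_ord_add_one[of "rk C" "rk C"] unfolding eq rk.simps
      by (blast intro: order_less_le_trans)
    ultimately show ?thesis
      using IH less \<open>\<alpha> < \<alpha> + \<beta>\<close> by (blast intro: lder.lcut)
  qed
next
  case (lck z C F' g E' \<beta>)
  have IH: "lder \<gamma> (\<alpha> + g k) (insert (s z, (box_all ^^ Suc k) C) F) E" for k
    by (rule lck.IH[of _ s]) (use lck.prems in \<open>auto intro: lder_weaken\<close>)
  have ck: "(s z, CK C) \<in> F" using lck.prems(1)[OF lck.hyps(1)] B by auto
  show ?case
    by (rule lder.lck[where g = "\<lambda>k. \<alpha> + g k", OF ck IH])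
      (rule ord_add_strict_mono, rule lck.hyps(3))
next
  case (lckdual z C F' k \<beta>1 E' \<beta>)
  have IH: "lder \<gamma> (\<alpha> + \<beta>1) (insert (s z, (dia_all ^^ k) C) F) E"
    by (rule lckdual.IH[of s]) (use lckdual.prems in \<open>auto intro: lder_weaken\<close>)
  have less: "\<alpha> + \<beta>1 < \<alpha> + \<beta>" using lckdual.hyps by (blast intro: ord_add_strict_mono)
  then have "\<alpha> < \<alpha> + \<beta>" by (rule order_le_less_trans[OF ord_add_ge_left])
  show ?case
  proof (cases "(s z, CKDual C) \<in> F")
    case True
    then show ?thesis using IH less lckdual.hyps by (blast intro: lder.lckdual)
  next
    case False
    then have eq: "s z = x" "B = CKDual C" using lckdual.prems(1)[OF lckdual.hyps(1)] by auto
    \<comment> \<open>The premises for \<open>CK\<close> start at exponent \<open>Suc 0\<close>, so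
      inversion at exponent k depends on k being positive.\<close>
    obtain m where m: "k = Suc m" using lckdual.hyps by (cases k) auto
    have "lder \<gamma> \<alpha> (insert (s z, neg ((dia_all ^^ k) C)) F) E"
    proof (rule lder_insert_covered[OF lckdual.prems(3)])
      show "cov (holds (insert (s z, neg ((dia_all ^^ k) C)) F)) (arrow E) x (neg B)"
        unfolding eq neg.simps neg_dia_all_power m by (rule cov_CK[of _ _ _ m], rule cov_here) simp
    qed (use lckdual.prems in auto)
    moreover have "rk ((dia_all ^^ k) C) < \<gamma>"
      using rk_dia_all_power_less B(1) unfolding eq by (rule order_less_le_trans)
    ultimately show ?thesis
      using IH less \<open>\<alpha> < \<alpha> + \<beta>\<close> by (blast intro: lder.lcut)
  qed
next
  case (lcut C \<beta>1 z F' E' \<beta> \<beta>2)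
  have "lder \<gamma> (\<alpha> + \<beta>1) (insert (s z, C) F) E"
    by (rule lcut.IH(1)[of s]) (use lcut.prems in \<open>auto intro: lder_weaken\<close>)
  moreover have "lder \<gamma> (\<alpha> + \<beta>2) (insert (s z, neg C) F) E"
    by (rule lcut.IH(2)[of s]) (use lcut.prems in \<open>auto intro: lder_weaken\<close>)
  ultimately show ?case using lcut.hyps by (blast intro: lder.lcut ord_add_strict_mono)
qed

text \<open>
  Both sides of a propositional cut are invertible. No induction is needed, and the induction of
  \<open>lder_reduction_aux\<close> would not yield the bound \<open>\<alpha> + \<beta>\<close> here, since two new cuts are stacked.
\<close>

lemma lder_reduction_propositional:
  fixes F :: "('l :: infinite \<times> ('i :: {finite, linorder}, 'p) fm) set"
    and \<gamma> :: "'o :: infinite ordinal"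
  assumes "lder \<gamma> \<alpha> (insert (x, And A B) F) E" "lder \<gamma> \<beta> (insert (x, Or (neg A) (neg B)) F) E"
    and "rk (And A B) \<le> \<gamma>" "finite F" "finite E" "\<alpha> \<le> \<delta>" "\<beta> \<le> \<delta>"
  shows "lder \<gamma> (\<delta> + 1 + 1) F E"
proof -
  \<comment> \<open>\<open>neg B\<close> is added by weakening so that this premise shares its side
    formulas with the inner cut on A; the outer cut on B then removes it.\<close>
  have A: "lder \<gamma> \<alpha> (insert (x, A) (insert (x, neg B) F)) E"
    by (rule lder_insert_covered[OF assms(1)]) (use assms in \<open>auto intro: cov_And1 cov_here\<close>)
  have B: "lder \<gamma> \<alpha> (insert (x, B) F) E"
    by (rule lder_insert_covered[OF assms(1)]) (use assms in \<open>auto intro: cov_And2 cov_here\<close>)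
  have AB: "lder \<gamma> \<beta> (insert (x, neg A) (insert (x, neg B) F)) E"
    by (rule lder_insert_covered[OF assms(2)]) (use assms in \<open>auto intro: cov_Or cov_here\<close>)
  have rk: "rk A < \<gamma>" "rk B < \<gamma>"
    using assms(3) by (auto simp: ord_add_one_le_iff)
  have "\<alpha> < \<delta> + 1" "\<beta> < \<delta> + 1" "\<alpha> < \<delta> + 1 + 1"
    using assms(6,7) by (auto intro: order_less_imp_le)
  then have "lder \<gamma> (\<delta> + 1) (insert (x, neg B) F) E"
    using A AB rk(1) by (blast intro: lder.lcut)
  then show ?thesis
    by (rule lder.lcut[OF rk(2) B \<open>\<alpha> < \<delta> + 1 + 1\<close>]) simp
qed

text \<open>The cut is oriented so that the formula followed by \<open>lder_reduction_aux\<close> is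
  a literal, a \<open>Dia\<close> or a \<open>CKDual\<close>; for \<open>Box\<close> and
  \<open>CK\<close> the premises swap roles. Since either order can occur, both sums of the depths
  must be bounded.\<close>

lemma lder_reduction:
  fixes F :: "('l :: infinite \<times> ('i :: {finite, linorder}, 'p) fm) set"
    and \<gamma> :: "'o :: infinite ordinal"
  assumes A: "lder \<gamma> \<alpha> (insert (x, A) F) E" and negA: "lder \<gamma> \<beta> (insert (x, neg A) F) E"
    and rk: "rk A \<le> \<gamma>" and fin: "finite F" "finite E"
    and le: "\<alpha> + \<beta> + 1 + 1 \<le> \<delta>" "\<beta> + \<alpha> + 1 + 1 \<le> \<delta>"
  shows "lder \<gamma> \<delta> F E"
proof -
  have le': "\<alpha> + \<beta> \<le> \<delta>" "\<beta> + \<alpha> \<le> \<delta>"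
    using le by (meson ord_add_ge_left order_trans)+
  have main: "lder \<gamma> \<delta> F E"
    if "lder \<gamma> \<alpha>' (insert (x, neg B) F) E" "lder \<gamma> \<beta>' (insert (x, B) F) E" "rk B \<le> \<gamma>" "\<alpha>' + \<beta>' \<le> \<delta>"
      "(\<exists>p. B = Pos p \<or> B = Neg p) \<or> (\<exists>i C. B = Dia i C) \<or> (\<exists>C. B = CKDual C)" for B \<alpha>' \<beta>'
  proof (rule lder_mono[OF _ that(4)])
    show "lder \<gamma> (\<alpha>' + \<beta>') F E"
      by (rule lder_reduction_aux[OF that(2), of "\<lambda>z. z"]) (use that fin in auto)
  qed
  have swap: "lder \<gamma> \<alpha> (insert (x, neg (neg A)) F) E" "rk (neg A) \<le> \<gamma>"
    using A rk by simp_all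
  have le_add: "\<alpha> \<le> \<alpha> + \<beta>" "\<beta> \<le> \<alpha> + \<beta>"
    by (simp_all add: ord_add_ge_right)
  show ?thesis
  proof (cases A)
    case (And B C)
    have "lder \<gamma> (\<alpha> + \<beta> + 1 + 1) F E"
      by (rule lder_reduction_propositional[of \<gamma> \<alpha> x B C F E \<beta>]) (use A negA rk fin le_add in \<open>simp_all add: And\<close>)
    then show ?thesis using le(1) by (rule lder_mono)
  next
    case (Or B C)
    have "lder \<gamma> (\<alpha> + \<beta> + 1 + 1) F E"
      by (rule lder_reduction_propositional[of \<gamma> \<beta> x "neg B" "neg C" F E \<alpha>])
        (use A negA rk fin le_add in \<open>simp_all add: Or\<close>)
    then show ?thesis using le(1) by (rule lder_mono)
  next
    case (Box i C)
    show ?thesis by (rule main[OF swap(1) negA swap(2) le'(1)]) (simp add: Box)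
  next
    case (CK C)
    show ?thesis by (rule main[OF swap(1) negA swap(2) le'(1)]) (simp add: CK)
  qed (rule main[OF negA A rk le'(2)], simp)+
qed

section \<open>Lowering the cut rank of a derivation\<close>

text \<open>Strict monotonicity of f keeps premises below conclusions, so every rule other than cut
  is simply repeated. What remains is a cut whose premises have already been transformed.\<close>

lemma lder_replace_cuts:
  fixes F :: "('l :: infinite \<times> ('i :: {finite, linorder}, 'p) fm) set"
  assumes "lder \<gamma> \<alpha> F E" "finite F" "finite E"
    and mono: "\<And>\<xi> \<zeta>. \<xi> < \<zeta> \<Longrightarrow> f \<xi> < f \<zeta>"
    and cut: "\<And>A \<alpha>1 \<alpha>2 \<alpha> x (F :: ('l \<times> ('i, 'p) fm) set) E. rk A < \<gamma> \<Longrightarrow>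
      lder \<gamma>' (f \<alpha>1) (insert (x, A) F) E \<Longrightarrow> \<alpha>1 < \<alpha> \<Longrightarrow>
      lder \<gamma>' (f \<alpha>2) (insert (x, neg A) F) E \<Longrightarrow> \<alpha>2 < \<alpha> \<Longrightarrow>
      finite F \<Longrightarrow> finite E \<Longrightarrow> lder \<gamma>' (f \<alpha>) F E"
  shows "lder \<gamma>' (f \<alpha>) F E"
  using assms(1-3)
proof (induction rule: lder.induct)
  case lax
  then show ?case by (intro lder.lax)
next
  case land
  show ?case
    by (rule lder.land[OF land.hyps(1) land.IH(1) mono[OF land.hyps(3)] land.IH(2) mono[OF land.hyps(5)]])
      (simp_all add: land.prems)
next
  case lor
  show ?case
    by (rule lder.lor[OF lor.hyps(1) lor.IH mono[OF lor.hyps(3)]]) (simp_all add: lor.prems)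
next
  case lbox
  show ?case
    by (rule lder.lbox[OF lbox.hyps(1,2) lbox.IH mono[OF lbox.hyps(4)]]) (simp_all add: lbox.prems)
next
  case ldia
  show ?case
    by (rule lder.ldia[OF ldia.hyps(1,2) ldia.IH mono[OF ldia.hyps(4)]]) (simp_all add: ldia.prems)
next
  case (lck x A F g)
  show ?case
    by (rule lder.lck[where g = "\<lambda>k. f (g k)", OF lck.hyps(1) lck.IH mono[OF lck.hyps(3)]])
      (simp_all add: lck.prems)
next
  case lckdual
  show ?case
    by (rule lder.lckdual[OF lckdual.hyps(1,2) lckdual.IH mono[OF lckdual.hyps(4)]])
      (simp_all add: lckdual.prems)
next
  case lcut
  show ?case
    by (rule cut[OF lcut.hyps(1) lcut.IH(1) lcut.hyps(3) lcut.IH(2) lcut.hyps(5)])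
      (simp_all add: lcut.prems)
qed

lemma lder_first_elimination:
  fixes F :: "('l :: infinite \<times> ('i :: {finite, linorder}, 'p) fm) set"
    and \<gamma> :: "'o :: infinite ordinal"
  assumes "lder (\<gamma> + 1) \<alpha> F E" "finite F" "finite E"
  shows "lder \<gamma> (omega_exp \<alpha>) F E"
proof (rule lder_replace_cuts[OF assms omega_exp_strict_mono])
  fix A :: "('i, 'p) fm" and \<alpha>1 \<alpha>2 \<alpha> :: "'o ordinal" and x and F :: "('l \<times> ('i, 'p) fm) set" and E
  assume "rk A < \<gamma> + 1" and less: "\<alpha>1 < \<alpha>" "\<alpha>2 < \<alpha>"
    and cut: "lder \<gamma> (omega_exp \<alpha>1) (insert (x, A) F) E" "lder \<gamma> (omega_exp \<alpha>2) (insert (x, neg A) F) E"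
      "finite F" "finite E"
  then have "rk A \<le> \<gamma>" by simp
  from cut(1,2) this cut(3,4) show "lder \<gamma> (omega_exp \<alpha>) F E"
    by (rule lder_reduction) (rule order_less_imp_le, rule omega_exp_sum_less, (rule less)+)+
qed

lemma lder_iterated_first_elimination:
  fixes F :: "('l :: infinite \<times> ('i :: {finite, linorder}, 'p) fm) set"
    and \<gamma> :: "'o :: infinite ordinal"
  assumes "lder (\<gamma> + ord_of_nat k) \<alpha> F E" "finite F" "finite E"
  shows "lder \<gamma> ((omega_exp ^^ k) \<alpha>) F E"
  using assms(1)
proof (induction k arbitrary: \<alpha>)
  case (Suc k)
  then have "lder (\<gamma> + ord_of_nat k) (omega_exp \<alpha>) F E"
    using assms by (intro lder_first_elimination) (simp_all add: ord_add_succ)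
  then show ?case unfolding funpow_Suc_right o_apply by (rule Suc.IH)
qed simp

lemma lder_second_elimination:
  fixes F :: "('l :: infinite \<times> ('i :: {finite, linorder}, 'p) fm) set"
    and \<gamma> :: "'o :: infinite ordinal"
  assumes "lder (\<gamma> + omega) \<alpha> F E" "finite F" "finite E"
  shows "lder \<gamma> (veblen 1 \<alpha>) F E"
proof (rule lder_replace_cuts[OF assms veblen_one_strict_mono])
  fix A :: "('i, 'p) fm" and \<alpha>1 \<alpha>2 \<alpha> :: "'o ordinal" and x and F :: "('l \<times> ('i, 'p) fm) set" and E
  assume rk: "rk A < \<gamma> + omega" and less: "\<alpha>1 < \<alpha>" "\<alpha>2 < \<alpha>"
    and cut: "lder \<gamma> (veblen 1 \<alpha>1) (insert (x, A) F) E" "lder \<gamma> (veblen 1 \<alpha>2) (insert (x, neg A) F) E"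
    and fin: "finite F" "finite E"
  obtain k where k: "rk A < \<gamma> + ord_of_nat k" using less_add_omegaD[OF rk] ..
  let ?\<xi> = "max (veblen 1 \<alpha>1) (veblen 1 \<alpha>2)"
  \<comment> \<open>The premises already have cut rank \<gamma>, so after restoring this one cut, k
    rounds of first elimination are enough. The number k depends on the cut and may be unbounded
    over the whole derivation.\<close>
  have "lder (\<gamma> + ord_of_nat k) (?\<xi> + 1) F E"
    by (rule lder.lcut[OF k lder_rank_mono[OF cut(1)] _ lder_rank_mono[OF cut(2)]]) simp_all
  then have 1: "lder \<gamma> ((omega_exp ^^ k) (?\<xi> + 1)) F E"
    using fin by (rule lder_iterated_first_elimination)
  have "?\<xi> < veblen 1 \<alpha>"
    using less by (simp add: veblen_one_strict_mono)
  then have "(omega_exp ^^ k) (?\<xi> + 1) < veblen 1 \<alpha>"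
    by (rule iterated_omega_exp_less_veblen_one[OF veblen_one_limit])
  then show "lder \<gamma> (veblen 1 \<alpha>) F E"
    by (rule lder_mono[OF 1 order_less_imp_le])
qed

text \<open>Since omega * (n + 1) = omega * n + omega, each round removes one block of
  \<open>omega\<close> ranks.\<close>

lemma lder_cut_elimination:
  fixes F :: "('l :: infinite \<times> ('i :: {finite, linorder}, 'p) fm) set"
    and \<alpha> :: "'o :: infinite ordinal"
  assumes "lder (omega * ord_of_nat n) \<alpha> F E" "finite F" "finite E"
  shows "lder 0 ((veblen 1 ^^ n) \<alpha>) F E"
  using assms(1)
proof (induction n arbitrary: \<alpha>)
  case (Suc n)
  then have "lder (omega * ord_of_nat n) (veblen 1 \<alpha>) F E"
    using assms by (intro lder_second_elimination) (simp_all add: ord_mult_succ)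
  then show ?case unfolding funpow_Suc_right o_apply by (rule Suc.IH)
qed simp

section \<open>From nested sequents to the labelled calculus\<close>

text \<open>A structure realizes a nested sequent without regard to multiplicities: equal formulas
  coincide and several boxes may be realized at one label.\<close>

inductive item_at :: "('l \<times> ('i :: {finite, linorder}, 'p) fm) set \<Rightarrow> ('l \<times> 'i \<times> 'l) set \<Rightarrow>
    'l \<Rightarrow> ('i, 'p) item \<Rightarrow> bool"
  for F E where
  "(x, A) \<in> F \<Longrightarrow> item_at F E x (Fm A)"
| "(x, i, y) \<in> E \<Longrightarrow> (\<And>it. it \<in># \<Delta> \<Longrightarrow> item_at F E y it) \<Longrightarrow> item_at F E x (Boxed i \<Delta>)"

inductive_simps item_at_simps [simp]: "item_at F E x (Fm A)" "item_at F E x (Boxed i \<Delta>)"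

definition sequent_at :: "('l \<times> ('i :: {finite, linorder}, 'p) fm) set \<Rightarrow> ('l \<times> 'i \<times> 'l) set \<Rightarrow>
    'l \<Rightarrow> ('i, 'p) sequent \<Rightarrow> bool" where
  "sequent_at F E x \<Gamma> \<longleftrightarrow> (\<forall>it. it \<in># \<Gamma> \<longrightarrow> item_at F E x it)"

text \<open>The last argument z is the label at which the hole is realized.\<close>

primrec ctxt_at :: "('l \<times> ('i :: {finite, linorder}, 'p) fm) set \<Rightarrow> ('l \<times> 'i \<times> 'l) set \<Rightarrow>
    'l \<Rightarrow> ('i, 'p) ctxt \<Rightarrow> 'l \<Rightarrow> bool" where
  "ctxt_at F E x (Here \<Gamma>) z \<longleftrightarrow> z = x \<and> sequent_at F E x \<Gamma>"
| "ctxt_at F E x (Under \<Gamma> i C) z \<longleftrightarrow> sequent_at F E x \<Gamma> \<and> (\<exists>y. (x, i, y) \<in> E \<and> ctxt_at F E y C z)"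

lemma sequent_at_simps [simp]:
  "sequent_at F E x {#}"
  "sequent_at F E x (add_mset it \<Gamma>) \<longleftrightarrow> item_at F E x it \<and> sequent_at F E x \<Gamma>"
  "sequent_at F E x (\<Gamma> + \<Delta>) \<longleftrightarrow> sequent_at F E x \<Gamma> \<and> sequent_at F E x \<Delta>"
  by (auto simp: sequent_at_def)

lemma item_at_Boxed: "item_at F E x (Boxed i \<Delta>) \<longleftrightarrow> (\<exists>y. (x, i, y) \<in> E \<and> sequent_at F E y \<Delta>)"
  by (auto simp: sequent_at_def)

declare item_at_simps(2) [simp del] item_at_Boxed [simp]

lemma sequent_at_fill:
  "sequent_at F E x (fill C \<Sigma>) \<longleftrightarrow> (\<exists>z. ctxt_at F E x C z \<and> sequent_at F E z \<Sigma>)"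
  by (induction C arbitrary: x) auto

lemma item_at_mono: "item_at F E x it \<Longrightarrow> F \<subseteq> F' \<Longrightarrow> E \<subseteq> E' \<Longrightarrow> item_at F' E' x it"
  by (induction rule: item_at.induct) (auto simp: sequent_at_def)

lemma sequent_at_mono:
  assumes "sequent_at F E x \<Gamma>" "F \<subseteq> F'" "E \<subseteq> E'"
  shows "sequent_at F' E' x \<Gamma>"
  unfolding sequent_at_def
proof (intro allI impI)
  fix it assume "it \<in># \<Gamma>"
  with assms(1) have "item_at F E x it" by (simp add: sequent_at_def)
  then show "item_at F' E' x it" using assms(2,3) by (rule item_at_mono)
qed

lemma ctxt_at_mono:
  "ctxt_at F E x C z \<Longrightarrow> F \<subseteq> F' \<Longrightarrow> E \<subseteq> E' \<Longrightarrow> ctxt_at F' E' x C z"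
  by (induction C arbitrary: x) (auto dest: sequent_at_mono)

lemma sequent_at_fill_mono:
  assumes "ctxt_at F E x C z" "F \<subseteq> F'" "E \<subseteq> E'" "sequent_at F' E' z \<Sigma>"
  shows "sequent_at F' E' x (fill C \<Sigma>)"
  unfolding sequent_at_fill using ctxt_at_mono[OF assms(1-3)] assms(4) by blast

lemma lsub_singleton_upper: "(\<xi> :: 'o :: infinite ordinal) < lsub {\<xi>}"
  using lsub_two_upper(1)[of \<xi> \<xi>] by simp

text \<open>Any structure realizing the conclusion realizes each premise once the active formulas
  are added at the label of the hole. The cumulative rules keep the rest, so the depth is
  unchanged.\<close>

lemma is_proof_lder:
  fixes F :: "('l :: infinite \<times> ('i :: {finite, linorder}, 'p) fm) set"
    and \<gamma> :: "'o :: infinite ordinal"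
  assumes "is_proof \<gamma> t" "sequent_at F E x (concl t)" "finite F" "finite E"
  shows "lder \<gamma> (depth t) F E"
  using assms
proof (induction arbitrary: F E rule: is_proof.induct)
  case (ax C p)
  then obtain z where "(z, Pos p) \<in> F" "(z, Neg p) \<in> F"
    by (auto simp: sequent_at_fill)
  then show ?case by (rule lder.lax)
next
  case (conj t C A u B)
  then obtain z where z: "ctxt_at F E x C z" "(z, And A B) \<in> F"
    by (auto simp: sequent_at_fill)
  have "sequent_at (insert (z, A) F) E x (concl t)" "sequent_at (insert (z, B) F) E x (concl u)"
    unfolding conj.hyps by (rule sequent_at_fill_mono[OF z(1)]; auto)+
  then have l: "lder \<gamma> (depth t) (insert (z, A) F) E" "lder \<gamma> (depth u) (insert (z, B) F) E"
    using conj.prems by (auto intro: conj.IH)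
  show ?case
    unfolding depth.simps by (rule lder.land[OF z(2) l(1) _ l(2)]) (rule lsub_two_upper)+
next
  case (disj t C A B)
  then obtain z where z: "ctxt_at F E x C z" "(z, Or A B) \<in> F"
    by (auto simp: sequent_at_fill)
  have "sequent_at (insert (z, A) (insert (z, B) F)) E x (concl t)"
    unfolding disj.hyps by (rule sequent_at_fill_mono[OF z(1)]) auto
  then have "lder \<gamma> (depth t) (insert (z, A) (insert (z, B) F)) E"
    using disj.prems by (auto intro: disj.IH)
  then show ?case
    unfolding depth.simps by (rule lder.lor[OF z(2) _ lsub_singleton_upper])
next
  case (box t C i A)
  then obtain z where z: "ctxt_at F E x C z" "(z, Box i A) \<in> F"
    by (auto simp: sequent_at_fill)
  \<comment> \<open>The new box of the premise is realized at a fresh successor.\<close>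
  obtain y where y: "fresh y F E" using box.prems fresh_exists by blast
  have "sequent_at (insert (y, A) F) (insert (z, i, y) E) x (concl t)"
    unfolding box.hyps by (rule sequent_at_fill_mono[OF z(1)]) auto
  then have "lder \<gamma> (depth t) (insert (y, A) F) (insert (z, i, y) E)"
    using box.prems by (auto intro: box.IH)
  then show ?case
    unfolding depth.simps by (rule lder.lbox[OF z(2) y _ lsub_singleton_upper])
next
  case (dia t C i A \<Delta>)
  then obtain z y where z: "ctxt_at F E x C z" "(z, Dia i A) \<in> F" "(z, i, y) \<in> E"
    and y: "sequent_at F E y \<Delta>"
    by (auto simp: sequent_at_fill)
  have "sequent_at (insert (y, A) F) E y \<Delta>"
    using y by (rule sequent_at_mono) auto
  then have "sequent_at (insert (y, A) F) E x (concl t)"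
    unfolding dia.hyps using z(2,3) by (intro sequent_at_fill_mono[OF z(1)]) auto
  then have "lder \<gamma> (depth t) (insert (y, A) F) E"
    using dia.prems by (auto intro: dia.IH)
  then show ?case
    unfolding depth.simps by (rule lder.ldia[OF z(2,3) _ lsub_singleton_upper])
next
  case (ck f C A)
  then obtain z where z: "ctxt_at F E x C z" "(z, CK A) \<in> F"
    by (auto simp: sequent_at_fill)
  have "sequent_at (insert (z, (box_all ^^ Suc k) A) F) E x (concl (f k))" for k
    unfolding ck.hyps by (rule sequent_at_fill_mono[OF z(1)]) auto
  then have "lder \<gamma> (depth (f k)) (insert (z, (box_all ^^ Suc k) A) F) E" for k
    by (rule ck.IH) (use ck.prems in auto)
  then show ?case
    unfolding depth.simps by (rule lder.lck[OF z(2) _ lsub_range_upper])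
next
  case (ckdual t k C A)
  then obtain z where z: "ctxt_at F E x C z" "(z, CKDual A) \<in> F"
    by (auto simp: sequent_at_fill)
  have "sequent_at (insert (z, (dia_all ^^ k) A) F) E x (concl t)"
    unfolding ckdual.hyps using z(2) by (intro sequent_at_fill_mono[OF z(1)]) auto
  then have "lder \<gamma> (depth t) (insert (z, (dia_all ^^ k) A) F) E"
    using ckdual.prems by (auto intro: ckdual.IH)
  then show ?case
    unfolding depth.simps by (rule lder.lckdual[OF z(2) ckdual.hyps(2) _ lsub_singleton_upper])
next
  case (cut t C A u)
  then obtain z where z: "ctxt_at F E x C z"
    by (auto simp: sequent_at_fill)
  have "sequent_at (insert (z, A) F) E x (concl t)" "sequent_at (insert (z, neg A) F) E x (concl u)"
    unfolding cut.hyps by (rule sequent_at_fill_mono[OF z]; auto)+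
  then have l: "lder \<gamma> (depth t) (insert (z, A) F) E" "lder \<gamma> (depth u) (insert (z, neg A) F) E"
    using cut.prems by (auto intro: cut.IH)
  show ?case
    unfolding depth.simps
    by (rule lder.lcut[OF \<open>rk A < \<gamma>\<close> l(1) _ l(2)]) (rule lsub_two_upper)+
qed

section \<open>Back to nested sequents\<close>

text \<open>
  Ordered representatives of nested sequents, whose nodes have addresses. The label of a node is
  the agent on the edge leading to it; the label of the root is irrelevant.
\<close>

datatype ('i, 'p) tree = Node (label: 'i) (formulas: "('i, 'p) fm multiset") (kids: "('i, 'p) tree list")

fun tree_sequent :: "('i, 'p) tree \<Rightarrow> ('i, 'p) sequent" where
  "tree_sequent (Node i M ts) =
    image_mset Fm M + mset (map (\<lambda>t. Boxed (label t) (tree_sequent t)) ts)"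

abbreviation boxed_trees :: "('i, 'p) tree list \<Rightarrow> ('i, 'p) sequent" where
  "boxed_trees ts \<equiv> mset (map (\<lambda>t. Boxed (label t) (tree_sequent t)) ts)"

primrec subtree :: "nat list \<Rightarrow> ('i, 'p) tree \<Rightarrow> ('i, 'p) tree option" where
  "subtree [] T = Some T"
| "subtree (k # a) T = (if k < length (kids T) then subtree a (kids T ! k) else None)"

text \<open>Together with \<open>edge\<close> this turns a tree into a labelled structure whose
  labels are addresses.\<close>

definition has :: "('i, 'p) tree \<Rightarrow> nat list \<Rightarrow> ('i, 'p) fm \<Rightarrow> bool" where
  "has T a A \<longleftrightarrow> (\<exists>S. subtree a T = Some S \<and> A \<in># formulas S)"

definition edge :: "('i, 'p) tree \<Rightarrow> nat list \<Rightarrow> 'i \<Rightarrow> nat list \<Rightarrow> bool" where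
  "edge T a i b \<longleftrightarrow>
    (\<exists>S k. subtree a T = Some S \<and> k < length (kids S) \<and> i = label (kids S ! k) \<and> b = a @ [k])"

abbreviation tsim :: "(nat list \<Rightarrow> nat list) \<Rightarrow> ('i :: {finite, linorder}, 'p) tree \<Rightarrow> ('i, 'p) tree \<Rightarrow> bool" where
  "tsim f T T' \<equiv> sim f (has T) (edge T) (has T') (edge T')"

abbreviation tcov :: "('i :: {finite, linorder}, 'p) tree \<Rightarrow> nat list \<Rightarrow> ('i, 'p) fm \<Rightarrow> bool" where
  "tcov T \<equiv> cov (has T) (edge T)"

lemma has_simps [simp]:
  "has T [] A \<longleftrightarrow> A \<in># formulas T"
  "has T (k # a) A \<longleftrightarrow> k < length (kids T) \<and> has (kids T ! k) a A"
  by (auto simp: has_def)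

lemma edge_simps [simp]:
  "edge T [] i b \<longleftrightarrow> (\<exists>k<length (kids T). b = [k] \<and> i = label (kids T ! k))"
  "edge T (k # a) i b \<longleftrightarrow> k < length (kids T) \<and> (\<exists>c. b = k # c \<and> edge (kids T ! k) a i c)"
  by (auto simp: edge_def)

section \<open>Trees as finite labelled structures\<close>

lemma sequent_tree_exists:
  fixes \<Gamma> :: "('i, 'p) sequent"
  shows "\<exists>T. label T = i \<and> tree_sequent T = \<Gamma>"
proof -
  \<comment> \<open>Stated for any sequent whose boxes have trees, since it is used both inside the
    induction on items and for the outermost sequent, which is not an item.\<close>
  have build: "\<exists>T. label T = i \<and> tree_sequent T = \<Gamma>"
    if "\<And>j \<Delta>. Boxed j \<Delta> \<in># \<Gamma> \<Longrightarrow> \<exists>T. label T = j \<and> tree_sequent T = \<Delta>" for i and \<Gamma> :: "('i, 'p) sequent"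
    using that
  proof (induction \<Gamma>)
    case empty
    show ?case by (rule exI[of _ "Node i {#} []"]) simp
  next
    case (add it \<Gamma>)
    then obtain T where "label T = i" "tree_sequent T = \<Gamma>" by fastforce
    then obtain M ts where T: "tree_sequent (Node i M ts) = \<Gamma>" by (cases T) auto
    show ?case
    proof (cases it)
      case (Fm A)
      with T show ?thesis by (intro exI[of _ "Node i (add_mset A M) ts"]) auto
    next
      case (Boxed j \<Delta>)
      then obtain S where "label S = j" "tree_sequent S = \<Delta>" using add.prems by fastforce
      with T Boxed show ?thesis by (intro exI[of _ "Node i M (S # ts)"]) auto
    qed
  qed
  have "\<forall>j \<Delta>. it = Boxed j \<Delta> \<longrightarrow> (\<exists>T. label T = j \<and> tree_sequent T = \<Delta>)" for it :: "('i, 'p) item"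
  proof (induction it)
    case (Boxed j \<Delta>)
    then show ?case using build by blast
  qed simp
  then show ?thesis using build by blast
qed

lemma finite_addresses: "finite {a. subtree a T \<noteq> None}"
proof (induction T)
  case (Node i M ts)
  have "{a. subtree a (Node i M ts) \<noteq> None} \<subseteq>
    insert [] (\<Union>k<length ts. (#) k ` {a. subtree a (ts ! k) \<noteq> None})"
  proof
    fix a assume "a \<in> {a. subtree a (Node i M ts) \<noteq> None}"
    then show "a \<in> insert [] (\<Union>k<length ts. (#) k ` {a. subtree a (ts ! k) \<noteq> None})"
      by (cases a) (auto split: if_splits)
  qed
  moreover have "finite (insert [] (\<Union>k<length ts. (#) k ` {a. subtree a (ts ! k) \<noteq> None}))"
    using Node by simp
  ultimately show ?case by (rule finite_subset)
qed

lemma finite_has: "finite {(a, A). has T a A}"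
proof (rule finite_subset)
  show "{(a, A). has T a A} \<subseteq>
    (SIGMA a:{a. subtree a T \<noteq> None}. set_mset (formulas (the (subtree a T))))"
    by (auto simp: has_def)
qed (intro finite_SigmaI finite_addresses finite_set_mset)

lemma finite_edge: "finite {(a, i, b). edge T a i b}"
proof (rule finite_subset)
  show "{(a, i, b). edge T a i b} \<subseteq>
    (\<lambda>(a, k). (a, label (kids (the (subtree a T)) ! k), a @ [k])) `
      (SIGMA a:{a. subtree a T \<noteq> None}. {..<length (kids (the (subtree a T)))})"
    by (force simp: edge_def)
qed (intro finite_imageI finite_SigmaI finite_addresses finite_lessThan)

text \<open>The prefix a is needed for the induction: the k-th child is realized at
  \<open>a @ [k]\<close>.\<close>

lemma sequent_at_tree:
  assumes "\<And>b A. has T b A \<Longrightarrow> (a @ b, A) \<in> F" "\<And>b i c. edge T b i c \<Longrightarrow> (a @ b, i, a @ c) \<in> E"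
  shows "sequent_at F E a (tree_sequent T)"
  using assms
proof (induction T arbitrary: a)
  case (Node i M ts)
  have "item_at F E a (Fm A)" if "A \<in># M" for A
    using that Node.prems(1)[of "[]" A] by simp
  moreover have "item_at F E a (Boxed (label t) (tree_sequent t))" if t: "t \<in> set ts" for t
  proof -
    obtain k where k: "k < length ts" "t = ts ! k" using t by (auto simp: in_set_conv_nth)
    have "sequent_at F E (a @ [k]) (tree_sequent t)"
    proof (rule Node.IH[OF t])
      show "((a @ [k]) @ b, A) \<in> F" if "has t b A" for b A
        using that k Node.prems(1)[of "k # b" A] by simp
      show "((a @ [k]) @ b, i, (a @ [k]) @ c) \<in> E" if "edge t b i c" for b i c
        using that k Node.prems(2)[of "k # b" i "k # c"] by simp
    qed
    moreover have "(a, label t, a @ [k]) \<in> E"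
      using k Node.prems(2)[of "[]" "label t" "[k]"] by simp
    ultimately show ?thesis by auto
  qed
  ultimately show ?case
    unfolding sequent_at_def by auto
qed

text \<open>
  The context \<open>C\<close> is chosen before \<open>N'\<close>, as the rules of \<open>D\<^sub>C\<close> need one context for all premises.
\<close>

lemma tree_replace:
  assumes "subtree a T = Some N"
  shows "\<exists>C. tree_sequent T = fill C (tree_sequent N) \<and>
    (\<forall>N'. label N' = label N \<longrightarrow> tsim (\<lambda>b. b) N N' \<longrightarrow>
      (\<exists>T'. label T' = label T \<and> tree_sequent T' = fill C (tree_sequent N') \<and>
        tsim (\<lambda>b. b) T T' \<and> tsim (\<lambda>b. a @ b) N' T'))"
  using assms
proof (induction a arbitrary: T)
  case Nil
  then have [simp]: "N = T" by simp
  have "tsim (\<lambda>b. b) N' N'" for N' :: "('a, 'b) tree"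
    by (rule simI) (auto intro: cov_here)
  then show ?case by (intro exI[of _ "Here {#}"]) auto
next
  case (Cons k a)
  obtain i M ts where T: "T = Node i M ts" by (cases T)
  let ?S = "ts ! k"
  have k: "k < length ts" and "subtree a ?S = Some N"
    using Cons.prems by (auto simp: T split: if_splits)
  from Cons.IH[OF this(2)] obtain C where C: "tree_sequent ?S = fill C (tree_sequent N)"
    and R: "\<And>N'. label N' = label N \<Longrightarrow> tsim (\<lambda>b. b) N N' \<Longrightarrow>
      \<exists>S'. label S' = label ?S \<and> tree_sequent S' = fill C (tree_sequent N') \<and>
        tsim (\<lambda>b. b) ?S S' \<and> tsim (\<lambda>b. a @ b) N' S'"
    by blast
  \<comment> \<open>The context keeps all siblings of the k-th child, so it does not depend on what
    replaces that child.\<close>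
  let ?C = "Under (image_mset Fm M + boxed_trees (take k ts @ drop (Suc k) ts)) (label ?S) C"
  have upd: "tree_sequent (Node i M (ts[k := S'])) = fill ?C \<Sigma>"
    if "label S' = label ?S" "tree_sequent S' = fill C \<Sigma>" for S' \<Sigma>
    using that k by (simp add: upd_conv_take_nth_drop)
  have "tree_sequent T = fill ?C (tree_sequent N)"
    using upd[OF refl C] by (simp add: T)
  moreover have "\<exists>T'. label T' = label T \<and> tree_sequent T' = fill ?C (tree_sequent N') \<and>
      tsim (\<lambda>b. b) T T' \<and> tsim (\<lambda>b. (k # a) @ b) N' T'"
    if N': "label N' = label N" "tsim (\<lambda>b. b) N N'" for N'
  proof -
    from R[OF N'] obtain S' where S': "label S' = label ?S" "tree_sequent S' = fill C (tree_sequent N')"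
      and sim: "tsim (\<lambda>b. b) ?S S'" "tsim (\<lambda>b. a @ b) N' S'" by blast
    let ?T = "Node i M (ts[k := S'])"
    have lift: "tsim (\<lambda>b. k # b) S' ?T"
      using k by (intro simI) (auto intro: cov_here)
    from sim_trans[OF sim(1) lift] have lift': "tsim (\<lambda>b. k # b) ?S ?T" .
    have "tsim (\<lambda>b. b) T ?T"
    proof (rule simI)
      fix b A assume b: "has T b A"
      show "tcov ?T b A"
      \<comment> \<open>Addresses through the k-th child are handled by the induction hypothesis;
        all others lead to unchanged nodes.\<close>
      proof (cases "\<exists>c. b = k # c")
        case True
        then show ?thesis using b k sim_holds[OF lift'] by (auto simp: T)
      next
        case False
        then have "has ?T b A" using b by (cases b) (auto simp: T)
        then show ?thesis by (rule cov_here)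
      qed
    next
      fix b j c assume b: "edge T b j c"
      show "edge ?T b j c"
      proof (cases "\<exists>d. b = k # d")
        case True
        then show ?thesis using b k sim_edge[OF lift'] by (auto simp: T)
      next
        case False
        \<comment> \<open>The edge from the root to the k-th child survives because the replacement
          has the same label.\<close>
        then show ?thesis using b S'(1) k by (cases b) (auto simp: T nth_list_update)
      qed
    qed
    moreover have "tsim (\<lambda>b. (k # a) @ b) N' ?T"
      using sim_trans[OF sim(2) lift] by simp
    ultimately show ?thesis
      using upd[OF S'] by (intro exI[of _ ?T]) (simp add: T)
  qed
  ultimately show ?case by blast
qed

section \<open>Premises of rule applications on trees\<close>

lemma fill_absorb: "\<exists>C'. \<forall>\<Sigma>. fill C (R + \<Sigma>) = fill C' \<Sigma>"
proof (induction C)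
  case (Here \<Gamma>)
  show ?case by (rule exI[of _ "Here (\<Gamma> + R)"]) (simp add: ac_simps)
next
  case (Under \<Gamma> i C)
  then obtain C' where "\<forall>\<Sigma>. fill C (R + \<Sigma>) = fill C' \<Sigma>" ..
  then show ?case by (intro exI[of _ "Under \<Gamma> i C'"]) simp
qed

text \<open>The unchanged part R of the node is moved into the context, leaving in the hole just the
  formulas and boxes on which a rule acts.\<close>

lemma tree_replace_part:
  assumes "subtree a T = Some N" "tree_sequent N = R + \<Sigma>"
  shows "\<exists>C. tree_sequent T = fill C \<Sigma> \<and>
    (\<forall>N' \<Sigma>'. label N' = label N \<longrightarrow> tree_sequent N' = R + \<Sigma>' \<longrightarrow> tsim (\<lambda>b. b) N N' \<longrightarrow>
      (\<exists>T'. tree_sequent T' = fill C \<Sigma>' \<and> tsim (\<lambda>b. b) T T' \<and> tsim (\<lambda>b. a @ b) N' T'))"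
proof -
  from tree_replace[OF assms(1)] obtain C where
    C: "tree_sequent T = fill C (tree_sequent N)"
      "\<And>N'. label N' = label N \<Longrightarrow> tsim (\<lambda>b. b) N N' \<Longrightarrow>
        \<exists>T'. tree_sequent T' = fill C (tree_sequent N') \<and> tsim (\<lambda>b. b) T T' \<and> tsim (\<lambda>b. a @ b) N' T'"
    by blast
  obtain C' where C': "\<And>\<Sigma>. fill C (R + \<Sigma>) = fill C' \<Sigma>" using fill_absorb by blast
  show ?thesis
  proof (intro exI[of _ C'] conjI allI impI)
    show "tree_sequent T = fill C' \<Sigma>" unfolding C(1) assms(2) C' ..
    fix N' \<Sigma>' assume "label N' = label N" "tree_sequent N' = R + \<Sigma>'" "tsim (\<lambda>b. b) N N'"
    with C(2)[of N'] show "\<exists>T'. tree_sequent T' = fill C' \<Sigma>' \<and> tsim (\<lambda>b. b) T T' \<and> tsim (\<lambda>b. a @ b) N' T'"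
      by (simp add: C')
  qed
qed

text \<open>T' represents a premise of a rule applied at address a in context C. Recording coverings
  alone suffices to extend a map into T by the active formulas.\<close>

definition replaces :: "('i :: {finite, linorder}, 'p) tree \<Rightarrow> nat list \<Rightarrow> ('i, 'p) ctxt \<Rightarrow>
    ('i, 'p) fm multiset \<Rightarrow> ('i, 'p) tree list \<Rightarrow> ('i, 'p) tree \<Rightarrow> bool" where
  "replaces T a C M us T' \<longleftrightarrow>
    tree_sequent T' = fill C (image_mset Fm M + boxed_trees us) \<and> tsim (\<lambda>b. b) T T' \<and>
    (\<forall>A. A \<in># M \<longrightarrow> tcov T' a A) \<and>
    (\<forall>u\<in>set us. \<exists>b. edge T' a (label u) b \<and> (\<forall>A. A \<in># formulas u \<longrightarrow> tcov T' b A))"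

text \<open>Losing \<open>P\<close> does no harm if M and us cover it at the node. This is required
  for every possible remainder of the node, because the statement hides that remainder. The context
  is fixed before M and us, so the premises of one rule share it.\<close>

lemma tree_principal:
  assumes "has T a P"
  shows "\<exists>C. tree_sequent T = fill C {#Fm P#} \<and>
    (\<forall>M us. (\<forall>i M0 ts. tcov (Node i (M + M0) (ts @ us)) [] P) \<longrightarrow> (\<exists>T'. replaces T a C M us T'))"
proof -
  from assms obtain N where N: "subtree a T = Some N" "P \<in># formulas N" by (auto simp: has_def)
  obtain M0 where "formulas N = add_mset P M0" using multi_member_split[OF N(2)] ..
  then obtain i ts where Neq: "N = Node i (add_mset P M0) ts" by (cases N) simp
  have "tree_sequent N = (image_mset Fm M0 + boxed_trees ts) + {#Fm P#}" by (simp add: Neq)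
  from tree_replace_part[OF N(1) this] obtain C where C: "tree_sequent T = fill C {#Fm P#}"
    and R: "\<And>N' \<Sigma>'. label N' = label N \<Longrightarrow> tree_sequent N' = (image_mset Fm M0 + boxed_trees ts) + \<Sigma>' \<Longrightarrow>
      tsim (\<lambda>b. b) N N' \<Longrightarrow>
      \<exists>T'. tree_sequent T' = fill C \<Sigma>' \<and> tsim (\<lambda>b. b) T T' \<and> tsim (\<lambda>b. a @ b) N' T'"
    by blast
  show ?thesis
  proof (rule exI[of _ C], rule conjI[OF C], intro allI impI)
    fix M us assume P: "\<forall>i M0 ts. tcov (Node i (M + M0) (ts @ us)) [] P"
    \<comment> \<open>New children go after the old ones, so old addresses keep their
      meaning.\<close>
    let ?N = "Node i (M + M0) (ts @ us)"
    have "tsim (\<lambda>b. b) N ?N"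
    proof (rule simI)
      show "tcov ?N b A" if "has N b A" for b A
        using that P by (cases b) (auto simp: Neq nth_append intro: cov_here)
      show "edge ?N b j c" if "edge N b j c" for b j c
        using that by (cases b) (auto simp: Neq nth_append)
    qed
    with R[of ?N "image_mset Fm M + boxed_trees us"] obtain T' where
      T': "tree_sequent T' = fill C (image_mset Fm M + boxed_trees us)" "tsim (\<lambda>b. b) T T'"
      and sim: "tsim (\<lambda>b. a @ b) ?N T'"
      by (auto simp: Neq ac_simps)
    have "tcov T' a A" if "A \<in># M" for A
      using that sim_holds[OF sim, of "[]" A] by simp
    moreover have "\<exists>b. edge T' a (label u) b \<and> (\<forall>A. A \<in># formulas u \<longrightarrow> tcov T' b A)"
      if u: "u \<in> set us" for u
    proof -
      obtain k where k: "k < length us" "u = us ! k" using u by (auto simp: in_set_conv_nth)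
      have "edge ?N [] (label u) [length ts + k]" using k by (simp add: nth_append)
      from sim_edge[OF sim this] have "edge T' a (label u) (a @ [length ts + k])" by simp
      moreover have "tcov T' (a @ [length ts + k]) A" if "A \<in># formulas u" for A
        using that k by (intro sim_holds[OF sim]) (simp add: nth_append)
      ultimately show ?thesis by blast
    qed
    ultimately show "\<exists>T'. replaces T a C M us T'"
      using T' unfolding replaces_def by blast
  qed
qed

lemma tree_principal_formulas:
  assumes "has T a P"
  obtains C where "tree_sequent T = fill C {#Fm P#}"
    "\<forall>M. (\<forall>i M0 ts. tcov (Node i (M + M0) ts) [] P) \<longrightarrow> (\<exists>T'. replaces T a C M [] T')"
proof -
  obtain C where C: "tree_sequent T = fill C {#Fm P#}"
    and R: "\<forall>M us. (\<forall>i M0 ts. tcov (Node i (M + M0) (ts @ us)) [] P) \<longrightarrow> (\<exists>T'. replaces T a C M us T')"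
    using tree_principal[OF assms] by (elim exE conjE)
  show ?thesis
    by (rule that[OF C]) (use R[rule_format, of _ "[]"] in simp)
qed

lemma tree_principal_Box:
  assumes "has T a (Box i A)"
  obtains C T' b where "tree_sequent T = fill C {#Fm (Box i A)#}"
    "tree_sequent T' = fill C {#Boxed i {#Fm A#}#}" "tsim (\<lambda>b. b) T T'" "edge T' a i b" "tcov T' b A"
proof -
  let ?u = "Node i {#A#} []"
  obtain C where C: "tree_sequent T = fill C {#Fm (Box i A)#}"
    and R: "\<forall>M us. (\<forall>j M0 ts. tcov (Node j (M + M0) (ts @ us)) [] (Box i A)) \<longrightarrow>
      (\<exists>T'. replaces T a C M us T')"
    using tree_principal[OF assms] by (elim exE conjE)
  have "tcov (Node j ({#} + M0) (ts @ [?u])) [] (Box i A)" for j M0 ts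
    by (rule cov_Box[of _ _ _ "[length ts]"], simp, rule cov_here, simp)
  with R obtain T' where "replaces T a C {#} [?u] T'" by blast
  then show ?thesis using that[OF C, of T'] by (auto simp: replaces_def)
qed

text \<open>The rule alters an existing child, whereas \<open>tree_principal\<close> only appends
  children. Here the k-th child is updated in place, and everything already in the tree
  stays.\<close>

lemma tree_principal_Dia:
  assumes "has T a (Dia i A)" "edge T a i b"
  obtains C \<Delta> T' where "tree_sequent T = fill C {#Fm (Dia i A), Boxed i \<Delta>#}"
    "tree_sequent T' = fill C {#Fm (Dia i A), Boxed i (\<Delta> + {#Fm A#})#}" "tsim (\<lambda>b. b) T T'" "tcov T' b A"
proof -
  from assms obtain N k where N: "subtree a T = Some N" "Dia i A \<in># formulas N"
    and k: "k < length (kids N)" "i = label (kids N ! k)" "b = a @ [k]"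
    by (auto simp: has_def edge_def)
  obtain M0 where "formulas N = add_mset (Dia i A) M0" using multi_member_split[OF N(2)] ..
  then obtain j ts where Neq: "N = Node j (add_mset (Dia i A) M0) ts" by (cases N) simp
  have "label (ts ! k) = i" using k(2) by (simp add: Neq)
  then obtain M ss where S: "ts ! k = Node i M ss" by (cases "ts ! k") simp
  have k_ts: "k < length ts" using k(1) by (simp add: Neq)
  let ?\<Delta> = "tree_sequent (ts ! k)" and ?S = "Node i (add_mset A M) ss"
  let ?N = "Node j (add_mset (Dia i A) M0) (ts[k := ?S])"
  let ?R = "image_mset Fm M0 + boxed_trees (take k ts @ drop (Suc k) ts)"
  have upd: "boxed_trees (ts[k := S']) = add_mset (Boxed (label S') (tree_sequent S'))
    (boxed_trees (take k ts @ drop (Suc k) ts))" for S'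
    using k_ts by (simp add: upd_conv_take_nth_drop)
  have "tree_sequent N = ?R + {#Fm (Dia i A), Boxed i ?\<Delta>#}"
    using upd[of "ts ! k", unfolded list_update_id] by (simp add: Neq S)
  from tree_replace_part[OF N(1) this] obtain C where
    C: "tree_sequent T = fill C {#Fm (Dia i A), Boxed i ?\<Delta>#}"
    and R: "\<And>N' \<Sigma>'. label N' = label N \<Longrightarrow> tree_sequent N' = ?R + \<Sigma>' \<Longrightarrow> tsim (\<lambda>b. b) N N' \<Longrightarrow>
      \<exists>T'. tree_sequent T' = fill C \<Sigma>' \<and> tsim (\<lambda>b. b) T T' \<and> tsim (\<lambda>b. a @ b) N' T'"
    by blast
  have N': "tree_sequent ?N = ?R + {#Fm (Dia i A), Boxed i (?\<Delta> + {#Fm A#})#}"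
    using upd[of ?S] by (simp add: S)
  have "has ?N c B" if "has N c B" for c B
  proof (cases c)
    case (Cons l d)
    then show ?thesis using that S by (cases "l = k"; cases d) (auto simp: Neq)
  qed (use that in \<open>simp add: Neq\<close>)
  moreover have "edge ?N c l d" if "edge N c l d" for c l d
  proof (cases c)
    case Nil
    then show ?thesis using that S k_ts by (auto simp: Neq nth_list_update)
  next
    case (Cons m e)
    then show ?thesis using that S by (cases "m = k"; cases e) (auto simp: Neq)
  qed
  ultimately have "tsim (\<lambda>b. b) N ?N" by (auto intro!: simI cov_here)
  with R[OF _ N'] obtain T' where
    T': "tree_sequent T' = fill C {#Fm (Dia i A), Boxed i (?\<Delta> + {#Fm A#})#}" "tsim (\<lambda>b. b) T T'"
      "tsim (\<lambda>b. a @ b) ?N T'"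
    by (auto simp: Neq)
  have "has ?N [k] A" using k_ts by simp
  from sim_holds[OF T'(3) this] show ?thesis
    by (intro that[OF C T'(1,2)]) (simp add: k(3))
qed

lemma tree_axiom:
  fixes T :: "('i :: {finite, linorder}, 'p) tree"
  assumes "has T a (Pos p)" "has T a (Neg p)"
  obtains C where "tree_sequent T = fill C {#Fm (Pos p), Fm (Neg p)#}"
proof -
  from assms obtain N where N: "subtree a T = Some N" "Pos p \<in># formulas N" "Neg p \<in># formulas N"
    by (auto simp: has_def)
  obtain i M ts where Neq: "N = Node i M ts" by (cases N)
  obtain M1 where M1: "M = add_mset (Pos p) M1"
    using multi_member_split[OF N(2)] by (auto simp: Neq)
  \<comment> \<open>Removing \<open>Pos p\<close> leaves the distinct formula \<open>Neg p\<close>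
    in the multiset.\<close>
  moreover have "Neg p \<in># M1" using N(3) by (simp add: Neq M1)
  from multi_member_split[OF this] obtain M2 where "M1 = add_mset (Neg p) M2" ..
  ultimately have "tree_sequent N = (image_mset Fm M2 + boxed_trees ts) + {#Fm (Pos p), Fm (Neg p)#}"
    by (simp add: Neq)
  from tree_replace_part[OF N(1) this] that show ?thesis by blast
qed

section \<open>Reading cut-free labelled derivations as nested proofs\<close>

lemma derivable_unary:
  assumes "D\<^sub>C \<turnstile>(\<alpha>1, \<gamma>) \<Gamma>1" "\<alpha>1 < \<alpha>"
    and "\<And>t. is_proof \<gamma> t \<Longrightarrow> concl t = \<Gamma>1 \<Longrightarrow> is_proof \<gamma> (Unary \<Gamma> t)"
  shows "D\<^sub>C \<turnstile>(\<alpha>, \<gamma>) \<Gamma>"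
proof -
  obtain t where t: "is_proof \<gamma> t" "concl t = \<Gamma>1" "depth t \<le> \<alpha>1"
    using assms(1) unfolding derivable_def by blast
  have "depth (Unary \<Gamma> t) \<le> \<alpha>"
    unfolding depth.simps using t(3) assms(2) by (auto intro!: lsub_least)
  then show ?thesis
    unfolding derivable_def using assms(3)[OF t(1,2)] by (intro exI[of _ "Unary \<Gamma> t"]) simp
qed

lemma derivable_mono: "D\<^sub>C \<turnstile>(\<alpha>, \<gamma>) \<Gamma> \<Longrightarrow> \<alpha> \<le> \<alpha>' \<Longrightarrow> D\<^sub>C \<turnstile>(\<alpha>', \<gamma>) \<Gamma>"
  by (auto simp: derivable_def intro: order_trans)

lemma sim_tree_insert:
  "sim f (holds F) e (has T) (edge T) \<Longrightarrow> tsim (\<lambda>b. b) T T' \<Longrightarrow> tcov T' (f x) A \<Longrightarrow>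
    sim f (holds (insert (x, A) F)) e (has T') (edge T')"
  by (rule sim_insert) (rule sim_trans)

text \<open>
  A rule application whose principal formula is decomposed rather than present in \<open>T\<close> is skipped by
  passing to a premise, so the non-cumulative rules of \<open>D\<^sub>C\<close> suffice without contraction.
\<close>

lemma lder_derivable:
  fixes \<alpha> :: "'o :: infinite ordinal"
  assumes "lder 0 \<alpha> F E" "sim f (holds F) (arrow E) (has T) (edge T)"
  shows "D\<^sub>C \<turnstile>(\<alpha>, 0) (tree_sequent T)"
  using assms
proof (induction arbitrary: f T rule: lder.induct)
  case (lax x p F \<alpha> E)
  then have "has T (f x) (Pos p)" "has T (f x) (Neg p)"
    using sim_holds[OF lax.prems lax.hyps(1)] sim_holds[OF lax.prems lax.hyps(2)]
    by (simp_all add: cov_simps)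
  then obtain C where "tree_sequent T = fill C {#Fm (Pos p), Fm (Neg p)#}" by (rule tree_axiom)
  then show ?case
    unfolding derivable_def
    by (intro exI[of _ "Leaf (tree_sequent T)"]) (auto intro: is_proof.ax lsub_least)
next
  case (land x A B F \<alpha>1 E \<alpha> \<alpha>2)
  note S = land.prems
  from sim_holds[OF S land.hyps(1)] show ?case
    unfolding cov_simps
  proof (elim disjE)
    assume "has T (f x) (And A B)"
    then obtain C where C: "tree_sequent T = fill C {#Fm (And A B)#}"
      and R: "\<forall>M. (\<forall>i M0 ts. tcov (Node i (M + M0) ts) [] (And A B)) \<longrightarrow> (\<exists>T'. replaces T (f x) C M [] T')"
      by (rule tree_principal_formulas)
    obtain T1 where T1: "tree_sequent T1 = fill C {#Fm A#}" "tsim (\<lambda>b. b) T T1" "tcov T1 (f x) A"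
    proof -
      have "tcov (Node i ({#A#} + M0) ts) [] (And A B)" for i M0 ts
        by (rule cov_And1, rule cov_here) simp
      from R[rule_format, OF this] that show ?thesis by (auto simp: replaces_def)
    qed
    obtain T2 where T2: "tree_sequent T2 = fill C {#Fm B#}" "tsim (\<lambda>b. b) T T2" "tcov T2 (f x) B"
    proof -
      have "tcov (Node i ({#B#} + M0) ts) [] (And A B)" for i M0 ts
        by (rule cov_And2, rule cov_here) simp
      from R[rule_format, OF this] that show ?thesis by (auto simp: replaces_def)
    qed
    obtain t where t: "is_proof (0 :: 'o ordinal) t" "concl t = fill C {#Fm A#}" "depth t \<le> \<alpha>1"
      using land.IH(1)[OF sim_tree_insert[OF S T1(2,3)]] by (auto simp: derivable_def T1(1))
    obtain u where u: "is_proof (0 :: 'o ordinal) u" "concl u = fill C {#Fm B#}" "depth u \<le> \<alpha>2"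
      using land.IH(2)[OF sim_tree_insert[OF S T2(2,3)]] by (auto simp: derivable_def T2(1))
    have "depth (Binary (tree_sequent T) t u) \<le> \<alpha>"
      unfolding depth.simps using t(3) u(3) land.hyps by (auto intro!: lsub_least)
    moreover have "is_proof (0 :: 'o ordinal) (Binary (tree_sequent T) t u)"
      unfolding C by (rule is_proof.conj) (fact t u)+
    ultimately show ?thesis unfolding derivable_def by fastforce
  next
    assume "tcov T (f x) A"
    with S have "D\<^sub>C \<turnstile>(\<alpha>1, 0) (tree_sequent T)" by (blast intro: land.IH(1) sim_insert)
    then show ?thesis using \<open>\<alpha>1 < \<alpha>\<close> by (auto intro: derivable_mono)
  next
    assume "tcov T (f x) B"
    with S have "D\<^sub>C \<turnstile>(\<alpha>2, 0) (tree_sequent T)" by (blast intro: land.IH(2) sim_insert)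
    then show ?thesis using \<open>\<alpha>2 < \<alpha>\<close> by (auto intro: derivable_mono)
  qed
next
  case (lor x A B F \<alpha>1 E \<alpha>)
  note S = lor.prems
  from sim_holds[OF S lor.hyps(1)] show ?case
    unfolding cov_simps
  proof (elim disjE conjE)
    assume "has T (f x) (Or A B)"
    then obtain C where C: "tree_sequent T = fill C {#Fm (Or A B)#}"
      and R: "\<forall>M. (\<forall>i M0 ts. tcov (Node i (M + M0) ts) [] (Or A B)) \<longrightarrow> (\<exists>T'. replaces T (f x) C M [] T')"
      by (rule tree_principal_formulas)
    obtain T1 where T1: "tree_sequent T1 = fill C {#Fm A, Fm B#}" "tsim (\<lambda>b. b) T T1"
      "tcov T1 (f x) A" "tcov T1 (f x) B"
    proof -
      have "tcov (Node i ({#A, B#} + M0) ts) [] (Or A B)" for i M0 ts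
        by (rule cov_Or; rule cov_here) simp_all
      from R[rule_format, OF this] that show ?thesis by (auto simp: replaces_def)
    qed
    have "sim f (holds (insert (x, A) (insert (x, B) F))) (arrow E) (has T1) (edge T1)"
      by (rule sim_insert[OF sim_tree_insert[OF S T1(2,4)] T1(3)])
    from lor.IH[OF this] show ?thesis
      unfolding T1 C by (rule derivable_unary[OF _ \<open>\<alpha>1 < \<alpha>\<close>]) (rule is_proof.disj)
  next
    assume "tcov T (f x) A" "tcov T (f x) B"
    with S have "D\<^sub>C \<turnstile>(\<alpha>1, 0) (tree_sequent T)" by (blast intro: lor.IH sim_insert)
    then show ?thesis using \<open>\<alpha>1 < \<alpha>\<close> by (auto intro: derivable_mono)
  qed
next
  case (lbox x i A F y E \<alpha>1 \<alpha>)
  note S = lbox.prems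
  from sim_holds[OF S lbox.hyps(1)] show ?case
    unfolding cov_simps
  proof (elim disjE exE conjE)
    assume "has T (f x) (Box i A)"
    then obtain C T' b where T': "tree_sequent T = fill C {#Fm (Box i A)#}"
      "tree_sequent T' = fill C {#Boxed i {#Fm A#}#}" "tsim (\<lambda>b. b) T T'" "edge T' (f x) i b" "tcov T' b A"
      by (rule tree_principal_Box)
    \<comment> \<open>The eigenlabel is interpreted as the address b of the newly created
      child.\<close>
    have "sim (f(y := b)) (holds (insert (y, A) F)) (arrow (insert (x, i, y) E)) (has T') (edge T')"
      by (rule sim_fresh[OF sim_trans[OF S T'(3)] lbox.hyps(2,1) T'(4,5)])
    from lbox.IH[OF this] show ?thesis
      unfolding T'(1,2) by (rule derivable_unary[OF _ \<open>\<alpha>1 < \<alpha>\<close>]) (rule is_proof.box)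
  next
    fix b assume "edge T (f x) i b" "tcov T b A"
    then have "sim (f(y := b)) (holds (insert (y, A) F)) (arrow (insert (x, i, y) E)) (has T) (edge T)"
      by (rule sim_fresh[OF S lbox.hyps(2,1)])
    from lbox.IH[OF this] show ?thesis using \<open>\<alpha>1 < \<alpha>\<close> by (auto intro: derivable_mono)
  qed
next
  case (ldia x i A F y E \<alpha>1 \<alpha>)
  note S = ldia.prems
  have "has T (f x) (Dia i A)" "edge T (f x) i (f y)"
    using sim_holds[OF S ldia.hyps(1)] sim_edge[OF S ldia.hyps(2)] by (simp_all add: cov_simps)
  then obtain C \<Delta> T' where T': "tree_sequent T = fill C {#Fm (Dia i A), Boxed i \<Delta>#}"
    "tree_sequent T' = fill C {#Fm (Dia i A), Boxed i (\<Delta> + {#Fm A#})#}" "tsim (\<lambda>b. b) T T'"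
    "tcov T' (f y) A"
    by (rule tree_principal_Dia)
  from ldia.IH[OF sim_tree_insert[OF S T'(3,4)]] show ?case
    unfolding T'(1,2) by (rule derivable_unary[OF _ \<open>\<alpha>1 < \<alpha>\<close>]) (rule is_proof.dia)
next
  case (lck x A F g E \<alpha>)
  note S = lck.prems
  from sim_holds[OF S lck.hyps(1)] show ?case
    unfolding cov_simps
  proof (elim disjE exE)
    assume "has T (f x) (CK A)"
    then obtain C where C: "tree_sequent T = fill C {#Fm (CK A)#}"
      and R: "\<forall>M. (\<forall>i M0 ts. tcov (Node i (M + M0) ts) [] (CK A)) \<longrightarrow> (\<exists>T'. replaces T (f x) C M [] T')"
      by (rule tree_principal_formulas)
    \<comment> \<open>The same C serves every k, as the infinitary rule demands; the subproofs are
      then chosen simultaneously.\<close>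
    have "\<exists>t. is_proof (0 :: 'o ordinal) t \<and> concl t = fill C {#Fm ((box_all ^^ Suc k) A)#} \<and> depth t \<le> g k" for k
    proof -
      let ?B = "(box_all ^^ Suc k) A"
      have "tcov (Node i ({#?B#} + M0) ts) [] (CK A)" for i M0 ts
        by (rule cov_CK[of _ _ _ k], rule cov_here) simp
      from R[rule_format, OF this] obtain T' where "replaces T (f x) C {#?B#} [] T'" ..
      then have
        T': "tree_sequent T' = fill C {#Fm ?B#}" "tsim (\<lambda>b. b) T T'" "tcov T' (f x) ?B"
        by (simp_all add: replaces_def)
      from lck.IH[OF sim_tree_insert[OF S T'(2,3)]] show ?thesis
        unfolding derivable_def T'(1) .
    qed
    then obtain t where t: "\<And>k. is_proof (0 :: 'o ordinal) (t k)"
      "\<And>k. concl (t k) = fill C {#Fm ((box_all ^^ Suc k) A)#}" "\<And>k. depth (t k) \<le> g k"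
      by metis
    have "depth (Infinitary (tree_sequent T) t) \<le> \<alpha>"
      unfolding depth.simps using t(3) lck.hyps(3) by (auto intro!: lsub_least intro: order_le_less_trans)
    moreover have "is_proof (0 :: 'o ordinal) (Infinitary (tree_sequent T) t)"
      unfolding C using t(1,2) by (rule is_proof.ck)
    ultimately show ?thesis unfolding derivable_def by fastforce
  next
    fix k assume "tcov T (f x) (box_all ((box_all ^^ k) A))"
    then have "tcov T (f x) ((box_all ^^ Suc k) A)" by simp
    with S have "D\<^sub>C \<turnstile>(g k, 0) (tree_sequent T)" by (blast intro: lck.IH sim_insert)
    then show ?thesis using lck.hyps(3)[of k] by (auto intro: derivable_mono)
  qed
next
  case (lckdual x A F k \<alpha>1 E \<alpha>)
  note S = lckdual.prems
  have "has T (f x) (CKDual A)"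
    using sim_holds[OF S lckdual.hyps(1)] by (simp add: cov_simps)
  then obtain C where C: "tree_sequent T = fill C {#Fm (CKDual A)#}"
    and R: "\<forall>M. (\<forall>i M0 ts. tcov (Node i (M + M0) ts) [] (CKDual A)) \<longrightarrow> (\<exists>T'. replaces T (f x) C M [] T')"
    by (rule tree_principal_formulas)
  obtain T1 where T1: "tree_sequent T1 = fill C {#Fm (CKDual A), Fm ((dia_all ^^ k) A)#}"
    "tsim (\<lambda>b. b) T T1" "tcov T1 (f x) ((dia_all ^^ k) A)"
  proof -
    \<comment> \<open>The premise retains \<open>CKDual A\<close>, so covering it takes no
      decomposition.\<close>
    have "tcov (Node i ({#CKDual A, (dia_all ^^ k) A#} + M0) ts) [] (CKDual A)" for i M0 ts
      by (rule cov_here) simp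
    from R[rule_format, OF this] that show ?thesis by (auto simp: replaces_def)
  qed
  from lckdual.IH[OF sim_tree_insert[OF S T1(2,3)]] show ?case
    unfolding T1(1) C
    by (rule derivable_unary[OF _ \<open>\<alpha>1 < \<alpha>\<close>]) (rule is_proof.ckdual[OF _ lckdual.hyps(2)])
next
  \<comment> \<open>No rank lies below 0, so this rule cannot occur.\<close>
  case lcut
  then show ?case by simp
qed

theorem theorem3p9:
  fixes n :: nat
    and \<alpha> :: "('o :: infinite) ordinal"
    and \<Gamma> :: "('i :: {finite, linorder}, 'p) sequent"
  assumes "D\<^sub>C \<turnstile>(\<alpha>, omega * ord_of_nat n) \<Gamma>"
  shows "D\<^sub>C \<turnstile>((veblen 1 ^^ n) \<alpha>, 0) \<Gamma>"
proof -
  obtain t where t: "is_proof (omega * ord_of_nat n :: 'o ordinal) t" "concl t = \<Gamma>" "depth t \<le> \<alpha>"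
    using assms unfolding derivable_def by blast
  \<comment> \<open>The label of the root is arbitrary, as it does not enter the sequent.\<close>
  obtain T :: "('i, 'p) tree" where T: "tree_sequent T = \<Gamma>"
    using sequent_tree_exists[of undefined \<Gamma>] by blast
  let ?F = "{(a, A). has T a A}" and ?E = "{(a, i, b). edge T a i b}"
  \<comment> \<open>The tree of \<Gamma> itself is the initial labelled structure. Its labels are
    lists of naturals, an infinite type, and finitely many occur, so fresh labels are
    available.\<close>
  have "sequent_at ?F ?E [] (concl t)"
    unfolding t(2) T[symmetric] by (rule sequent_at_tree) simp_all
  from is_proof_lder[OF t(1) this finite_has finite_edge]
  have "lder (omega * ord_of_nat n) \<alpha> ?F ?E"
    using t(3) by (rule lder_mono)
  then have "lder 0 ((veblen 1 ^^ n) \<alpha>) ?F ?E"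
    using finite_has finite_edge by (rule lder_cut_elimination)
  \<comment> \<open>Cut elimination keeps the labelled end sequent, so the identity map leads back
    to the same tree.\<close>
  moreover have "sim (\<lambda>a. a) (holds ?F) (arrow ?E) (has T) (edge T)"
    by (rule simI) (auto intro: cov_here)
  ultimately show ?thesis
    unfolding T[symmetric] by (rule lder_derivable)
qed

end
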